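(* \begin{align*} \widetilde{\Phi}_{0,1}(-e^{-\pi})&=\frac{1}{4\pi}-\frac18, & \widetilde{\Phi}_{0,5}(-e^{-\pi})&=-\frac18,\\ \widetilde{\Phi}_{1,6}(-e^{-\pi})&=-\frac{\pi^{4}}{16\,\Gamma^{16}\left(\tfrac34\right)}, & \widetilde{\Phi}_{2,7}(-e^{-\pi})&=-\frac{7\pi^{3}}{16\,\Gamma^{16}\left(\tfrac34\right)}. \end{align*}
   Context: For $n\ge1$ let $\widetilde{\sigma}_{s}(n)=\sum_{d\mid n}(-1)^{d-1}d^{s}$. For integers $s\ge r\ge 0$ and $q\in\mathbf{C}$ with $|q|<1$ define $$\widetilde{\Phi}_{r,s}(q)=\left(q\frac{d}{dq}\right)^{r}\sum_{n=1}^{\infty}\widetilde{\sigma}_{s-r}(n)q^{n}=\sum_{n=1}^{\infty}n^{r}\,\widetilde{\sigma}_{s-r}(n)q^{n}.$$ $\Gamma$ is the Gamma function and $\Gamma^{16}(x)=(\Gamma(x))^{16}$. *)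

theory Defs
  imports "HOL-Analysis.Analysis"
begin

definition sigma_tilde :: "nat \<Rightarrow> nat \<Rightarrow> int" where
  "sigma_tilde s n = (\<Sum>d | d dvd n. (- 1) ^ (d - 1) * int d ^ s)"

definition q_deriv :: "(complex \<Rightarrow> complex) \<Rightarrow> complex \<Rightarrow> complex" where
  "q_deriv f q = q * deriv f q"

text \<open>
  The parameters are meant to satisfy \<open>r \<le> s\<close> (the subtraction is truncated) and
  \<open>norm q < 1\<close>. The sum over \<open>n \<ge> 1\<close> is written with a shifted index.
\<close>
definition Phi_tilde :: "nat \<Rightarrow> nat \<Rightarrow> complex \<Rightarrow> complex" where
  "Phi_tilde r s =
     (q_deriv ^^ r) (\<lambda>q. \<Sum>n. of_int (sigma_tilde (s - r) (Suc n)) * q ^ Suc n)"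

lemma q_deriv_power_series:
  fixes c :: "nat \<Rightarrow> complex"
  assumes sm: "\<And>z. norm z < 1 \<Longrightarrow> summable (\<lambda>n. c n * z ^ n)" and q: "norm q < 1"
  shows "(\<lambda>n. of_nat n * c n * q ^ n) sums q_deriv (\<lambda>z. \<Sum>n. c n * z ^ n) q"
proof -
  obtain K :: real where K: "norm q < K" "K < 1"
    using q dense by blast
  have K0: "norm (complex_of_real K) = K"
    using K norm_ge_zero[of q] by (simp del: norm_ge_zero)
  have "((\<lambda>z. \<Sum>n. c n * z ^ n) has_field_derivative (\<Sum>n. diffs c n * q ^ n)) (at q)"
    by (rule termdiffs_strong[where K = "of_real K"]) (use K K0 sm in auto)
  then have d: "deriv (\<lambda>z. \<Sum>n. c n * z ^ n) q = (\<Sum>n. diffs c n * q ^ n)"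
    by (rule DERIV_imp_deriv)
  have "summable (\<lambda>n. diffs c n * q ^ n)"
    by (rule termdiff_converges[OF q sm])
  then have "(\<lambda>n. q * (diffs c n * q ^ n)) sums q_deriv (\<lambda>z. \<Sum>n. c n * z ^ n) q"
    unfolding q_deriv_def d by (intro sums_mult summable_sums)
  then have "(\<lambda>n. of_nat (Suc n) * c (Suc n) * q ^ Suc n) sums
               q_deriv (\<lambda>z. \<Sum>n. c n * z ^ n) q"
    by (simp add: diffs_def mult_ac)
  then show ?thesis
    by (subst (asm) sums_Suc_iff) simp
qed

lemma q_deriv_cong:
  assumes "\<And>z. norm z < 1 \<Longrightarrow> f z = g z" "norm q < 1"
  shows "q_deriv f q = q_deriv g q"
proof -
  have "\<forall>\<^sub>F z in nhds q. z \<in> ball 0 1"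
    using assms(2) by (intro eventually_nhds_in_open) auto
  then have "\<forall>\<^sub>F z in nhds q. f z = g z"
    by (rule eventually_mono) (use assms(1) in auto)
  then show ?thesis
    unfolding q_deriv_def by (simp add: deriv_cong_ev)
qed

lemma q_deriv_funpow_power_series:
  fixes c :: "nat \<Rightarrow> complex"
  assumes sm: "\<And>z. norm z < 1 \<Longrightarrow> summable (\<lambda>n. c n * z ^ n)" and q: "norm q < 1"
  shows "(\<lambda>n. of_nat n ^ r * c n * q ^ n) sums (q_deriv ^^ r) (\<lambda>z. \<Sum>n. c n * z ^ n) q"
  using q
proof (induction r arbitrary: q)
  case 0
  then show ?case using sm by (simp add: summable_sums)
next
  case (Suc r)
  have "(\<lambda>n. of_nat n * (of_nat n ^ r * c n) * q ^ n) sums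
          q_deriv (\<lambda>z. \<Sum>n. of_nat n ^ r * c n * z ^ n) q"
    by (rule q_deriv_power_series) (use Suc sums_summable in blast)+
  moreover have "q_deriv (\<lambda>z. \<Sum>n. of_nat n ^ r * c n * z ^ n) q =
                   q_deriv ((q_deriv ^^ r) (\<lambda>z. \<Sum>n. c n * z ^ n)) q"
    by (rule q_deriv_cong) (use Suc in \<open>auto simp: sums_iff\<close>)
  ultimately show ?case by (simp add: mult_ac)
qed

lemma norm_sigma_tilde_le: "norm (of_int (sigma_tilde s n) :: complex) \<le> real n ^ Suc s"
proof (cases "n = 0")
  case False
  have fin: "finite {d. d dvd n}" using False by simp
  have "\<bar>sigma_tilde s n\<bar> \<le> (\<Sum>d | d dvd n. \<bar>(- 1) ^ (d - 1) * int d ^ s\<bar>)"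
    unfolding sigma_tilde_def by (rule sum_abs)
  also have "\<dots> \<le> (\<Sum>d | d dvd n. int n ^ s)"
    using False by (intro sum_mono) (auto simp: abs_mult power_abs intro!: power_mono dvd_imp_le)
  also have "\<dots> = int (card {d. d dvd n}) * int n ^ s"
    by simp
  also have "\<dots> \<le> int n * int n ^ s"
  proof -
    have "{d. d dvd n} \<subseteq> {1..n}"
      using False by (auto intro: dvd_imp_le simp: Suc_le_eq dvd_pos_nat)
    then have "card {d. d dvd n} \<le> n"
      using card_mono[of "{1..n}" "{d. d dvd n}"] by simp
    then show ?thesis by (intro mult_right_mono) auto
  qed
  finally have "\<bar>sigma_tilde s n\<bar> \<le> int n ^ Suc s" by simp
  then have "real_of_int \<bar>sigma_tilde s n\<bar> \<le> real_of_int (int n ^ Suc s)"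
    by (simp only: of_int_le_iff)
  then show ?thesis by simp
qed (simp add: sigma_tilde_def)

lemma summable_sigma_tilde:
  assumes "norm (z::complex) < 1"
  shows "summable (\<lambda>n. of_int (sigma_tilde s n) * z ^ n)"
proof (rule summable_comparison_test')
  have "summable (\<lambda>n. real n ^ Suc s * norm z ^ n)"
  proof -
    have "(\<lambda>n. of_nat n ^ Suc s * 1 * of_real (norm z) ^ n) sums
            (q_deriv ^^ Suc s) (\<lambda>z. \<Sum>n. 1 * z ^ n) (complex_of_real (norm z))"
      by (rule q_deriv_funpow_power_series) (use assms in auto)
    then have "summable (\<lambda>n. complex_of_real (real n ^ Suc s * norm z ^ n))"
      by (simp add: sums_iff)
    then show ?thesis by (simp only: summable_complex_of_real)
  qed
  then show "summable (\<lambda>n. real n ^ Suc s * norm z ^ n)" .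
  show "norm (of_int (sigma_tilde s n) * z ^ n) \<le> real n ^ Suc s * norm z ^ n" for n
    using norm_sigma_tilde_le[of s n]
    by (simp add: norm_mult norm_power mult_right_mono del: power_Suc norm_of_int)
qed

theorem Phi_tilde_sums:
  assumes "norm q < 1"
  shows "(\<lambda>n. of_nat (Suc n) ^ r * of_int (sigma_tilde (s - r) (Suc n)) * q ^ Suc n)
           sums Phi_tilde r s q"
proof -
  let ?c = "\<lambda>n. complex_of_int (sigma_tilde (s - r) n)"
  have c0: "?c 0 = 0" by (simp add: sigma_tilde_def)
  have eq: "(\<Sum>n. ?c (Suc n) * z ^ Suc n) = (\<Sum>n. ?c n * z ^ n)" if "norm z < 1" for z
    using suminf_split_head[OF summable_sigma_tilde[OF that, of "s - r"]] c0 by simp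
  let ?f = "\<lambda>z. \<Sum>n. ?c (Suc n) * z ^ Suc n" and ?g = "\<lambda>z. \<Sum>n. ?c n * z ^ n"
  have "(q_deriv ^^ k) ?f z = (q_deriv ^^ k) ?g z" if "norm z < 1" for k z
    using that
  proof (induction k arbitrary: z)
    case 0
    then show ?case using eq by simp
  next
    case (Suc k)
    have "q_deriv ((q_deriv ^^ k) ?f) z = q_deriv ((q_deriv ^^ k) ?g) z"
      by (rule q_deriv_cong) (use Suc in blast)+
    then show ?case by simp
  qed
  then have Phi: "Phi_tilde r s q = (q_deriv ^^ r) ?g q"
    unfolding Phi_tilde_def using assms by blast
  have "(\<lambda>n. of_nat n ^ r * ?c n * q ^ n) sums Phi_tilde r s q"
    unfolding Phi by (rule q_deriv_funpow_power_series[OF summable_sigma_tilde assms])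
  then show ?thesis
    using c0 by (subst sums_Suc_iff) simp
qed

end

theory Submission
  imports Defs "HOL-Complex_Analysis.Complex_Analysis"
begin

text \<open>
  Put \<open>q = exp (2 \<pi> \<i> \<tau>)\<close>. The Taylor coefficients at the half period \<open>1 / 2\<close> of a suitably normalised
  Weierstrass zeta function of the lattice spanned by \<open>1\<close> and \<open>\<tau>\<close> are, up to elementary constants, the values
  \<open>Phi_tilde 0 s q\<close> with \<open>s\<close> odd. Liouville's theorem yields the differential equation of \<open>\<wp>\<close>,
  Ramanujan's identity for the square of the zeta function (which brings in \<open>Phi_tilde 1 s q\<close>), and the
  behaviour of \<open>\<wp>\<close> under similarities of lattices.

  The nome \<open>q = - exp (- \<pi>)\<close> belongs to \<open>\<tau> = (1 + \<i>) / 2\<close>, whose lattice is stable under multiplication by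
  \<open>\<i>\<close>. This symmetry and Legendre's relation give \<open>Phi_tilde 0 1\<close> and \<open>Phi_tilde 0 5\<close> and express
  \<open>Phi_tilde 1 6\<close> by the square of \<open>1 - 16 Phi_tilde 0 3\<close>. Along the real line \<open>\<wp>\<close> is lemniscatic, and its real
  period is a Beta integral, which determines \<open>Phi_tilde 0 3\<close> in terms of \<open>\<Gamma>(1/4)\<close>. Finally,
  \<open>t \<mapsto> 1 + 8 Phi_tilde 0 5 (- exp (- \<pi> t))\<close> is multiplied by \<open>- t\<^sup>6\<close> when \<open>t\<close> is replaced by \<open>1 / t\<close>;
  two derivatives at \<open>t = 1\<close> give \<open>Phi_tilde 2 7\<close> from \<open>Phi_tilde 1 6\<close>.
\<close>

section \<open>Elliptic functions\<close>

text \<open>The half period 1/2 is chosen because \<open>nome (1 / 2) = - 1\<close>: expanding there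
  inserts (-1)^d into a Lambert series, which up to an overall sign is the sign in
  \<open>sigma_tilde\<close>. Building the zeta function from sums over translates by \<tau>, and
  not from sums over lattice points, makes the quasi-periods telescope and avoids conditionally
  convergent Eisenstein series. The price is an additive constant in \<wp> that does not scale with
  the lattice; lattices are therefore compared through derivatives, or at a half period that
  determines the constant. Multiplication by \<i>/t carries 1/2 to a point congruent to 1/2, so no
  other half period has to be evaluated. The square of the zeta function is not elliptic; a second
  telescoping sum repairs this, and its denominators (1 - q^k)^2 are what brings in r = 1. The only
  transcendental input beyond \<pi> is F = 1 - 16 \<open>Phi_tilde 0 3 q0\<close>: the real period
  yields F = \<pi>^2 / \<Gamma>(3/4)^8, and \<open>Phi_tilde 1 6 q0\<close> = - F^2 / 16 accounts
  for the sixteenth power.\<close>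

definition lattice :: "complex \<Rightarrow> complex set" where
  "lattice \<tau> = {of_int m + of_int n * \<tau> | m n. True}"

lemma latticeI: "of_int m + of_int n * \<tau> \<in> lattice \<tau>"
  unfolding lattice_def by blast

lemma zero_in_lattice [simp]: "0 \<in> lattice \<tau>"
  using latticeI[of 0 0 \<tau>] by simp

lemma one_in_lattice [simp]: "1 \<in> lattice \<tau>"
  using latticeI[of 1 0 \<tau>] by simp

lemma tau_in_lattice [simp]: "\<tau> \<in> lattice \<tau>"
  using latticeI[of 0 1 \<tau>] by simp

lemma lattice_add: "z \<in> lattice \<tau> \<Longrightarrow> w \<in> lattice \<tau> \<Longrightarrow> z + w \<in> lattice \<tau>"
proof -
  assume "z \<in> lattice \<tau>" "w \<in> lattice \<tau>"
  then obtain m n m' n' where "z = of_int m + of_int n * \<tau>" "w = of_int m' + of_int n' * \<tau>"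
    unfolding lattice_def by blast
  then have "z + w = of_int (m + m') + of_int (n + n') * \<tau>"
    by (simp add: algebra_simps)
  then show ?thesis by (simp only: latticeI)
qed

lemma lattice_uminus: "z \<in> lattice \<tau> \<Longrightarrow> - z \<in> lattice \<tau>"
proof -
  assume "z \<in> lattice \<tau>"
  then obtain m n where "z = of_int m + of_int n * \<tau>"
    unfolding lattice_def by blast
  then have "- z = of_int (- m) + of_int (- n) * \<tau>"
    by simp
  then show ?thesis by (simp only: latticeI)
qed

lemma lattice_uminus_iff [simp]: "- z \<in> lattice \<tau> \<longleftrightarrow> z \<in> lattice \<tau>"
  using lattice_uminus[of z] lattice_uminus[of "- z"] by auto

lemma lattice_diff: "z \<in> lattice \<tau> \<Longrightarrow> w \<in> lattice \<tau> \<Longrightarrow> z - w \<in> lattice \<tau>"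
  using lattice_add[of z \<tau> "- w"] by simp

lemma lattice_add_iff [simp]: "w \<in> lattice \<tau> \<Longrightarrow> z + w \<in> lattice \<tau> \<longleftrightarrow> z \<in> lattice \<tau>"
  using lattice_add[of z \<tau> w] lattice_diff[of "z + w" \<tau> w] by auto

lemma lattice_diff_iff [simp]: "w \<in> lattice \<tau> \<Longrightarrow> w - z \<in> lattice \<tau> \<longleftrightarrow> z \<in> lattice \<tau>"
  using lattice_add_iff[of w \<tau> "- z"] by simp

lemma lattice_of_int_mult: "z \<in> lattice \<tau> \<Longrightarrow> of_int k * z \<in> lattice \<tau>"
proof -
  assume "z \<in> lattice \<tau>"
  then obtain m n where "z = of_int m + of_int n * \<tau>"
    unfolding lattice_def by blast
  then have "of_int k * z = of_int (k * m) + of_int (k * n) * \<tau>"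
    by (simp add: algebra_simps)
  then show ?thesis by (simp only: latticeI)
qed

lemma lattice_discrete:
  assumes "Im \<tau> > 0" "z \<in> lattice \<tau>" "norm z < min 1 (Im \<tau>)"
  shows "z = 0"
proof -
  obtain m n where z: "z = of_int m + of_int n * \<tau>"
    using assms(2) unfolding lattice_def by blast
  have "\<bar>Im z\<bar> < Im \<tau>"
    using abs_Im_le_cmod[of z] assms by simp
  then have "\<bar>real_of_int n\<bar> * Im \<tau> < 1 * Im \<tau>"
    using assms(1) by (simp add: z abs_mult)
  then have "\<bar>real_of_int n\<bar> < 1"
    using assms(1) by (subst (asm) mult_less_cancel_right_pos)
  then have n: "n = 0" by linarith
  then have "\<bar>real_of_int m\<bar> < 1"
    using abs_Re_le_cmod[of z] assms by (simp add: z)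
  then have "m = 0" by linarith
  with n show ?thesis by (simp add: z)
qed

lemma closed_lattice:
  assumes "Im \<tau> > 0"
  shows "closed (lattice \<tau>)"
proof (rule discrete_imp_closed)
  show "0 < min 1 (Im \<tau>)" using assms by simp
  show "\<forall>x\<in>lattice \<tau>. \<forall>y\<in>lattice \<tau>. dist y x < min 1 (Im \<tau>) \<longrightarrow> y = x"
    using lattice_discrete[OF assms lattice_diff] by (auto simp: dist_norm)
qed

lemma open_compl_lattice: "Im \<tau> > 0 \<Longrightarrow> open (- lattice \<tau>)"
  using closed_lattice by (simp add: open_Compl)

text \<open>A countable set cannot disconnect the plane. This is needed where a vanishing derivative
  off the lattice has to force a constant.\<close>

lemma connected_compl_lattice:
  assumes "Im \<tau> > 0"
  shows "connected (- lattice \<tau>)"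
proof -
  have "lattice \<tau> = (\<lambda>(m, n). of_int m + of_int n * \<tau>) ` UNIV"
    unfolding lattice_def by auto
  then have "countable (lattice \<tau>)" by simp
  then have "connected (UNIV - lattice \<tau>)"
    by (intro connected_convex_diff_countable) (auto simp: collinear_aff_dim)
  then show ?thesis by (simp add: Compl_eq_Diff_UNIV)
qed

lemma lattice_quasi_periodic:
  fixes f :: "complex \<Rightarrow> complex"
  assumes "\<And>z. z \<notin> lattice \<tau> \<Longrightarrow> f (z + a) = f z" "a \<in> lattice \<tau>" "z \<notin> lattice \<tau>"
  shows "f (z + of_int k * a) = f z"
proof (induction k rule: int_induct[where k = 0])
  case (step1 i)
  have "z + of_int i * a \<notin> lattice \<tau>"
    using assms by (simp add: lattice_of_int_mult)
  from assms(1)[OF this] step1 show ?case by (simp add: algebra_simps)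
next
  case (step2 i)
  have "z + of_int (i - 1) * a \<notin> lattice \<tau>"
    using assms by (simp add: lattice_of_int_mult del: of_int_diff)
  from assms(1)[OF this] step2 show ?case by (simp add: algebra_simps)
qed simp

lemma lattice_periodic:
  fixes f :: "complex \<Rightarrow> complex"
  assumes "\<And>z. z \<notin> lattice \<tau> \<Longrightarrow> f (z + 1) = f z" "\<And>z. z \<notin> lattice \<tau> \<Longrightarrow> f (z + \<tau>) = f z"
    "w \<in> lattice \<tau>" "z \<notin> lattice \<tau>"
  shows "f (z + w) = f z"
proof -
  obtain m n where w: "w = of_int m + of_int n * \<tau>"
    using assms(3) unfolding lattice_def by blast
  have "f (z + of_int m * 1 + of_int n * \<tau>) = f (z + of_int m * 1)"
    using assms lattice_of_int_mult[OF one_in_lattice, of m \<tau>]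
    by (intro lattice_quasi_periodic[where \<tau> = \<tau>]) simp_all
  also have "\<dots> = f z"
    using assms by (intro lattice_quasi_periodic[where \<tau> = \<tau>]) simp_all
  finally show ?thesis by (simp add: w add.assoc)
qed

lemma bounded_range_doubly_periodic:
  fixes f :: "complex \<Rightarrow> complex"
  assumes "Im \<tau> > 0" "continuous_on UNIV f" "\<And>z w. w \<in> lattice \<tau> \<Longrightarrow> f (z + w) = f z"
  shows "bounded (range f)"
proof -
  define K where "K = (\<lambda>(a, b). complex_of_real a + of_real b * \<tau>) ` (cbox (0, 0) (1, 1))"
  have "compact K"
    unfolding K_def
    by (intro compact_continuous_image compact_cbox) (auto intro!: continuous_intros simp: case_prod_unfold)
  then have "bounded (f ` K)"
    by (intro compact_imp_bounded compact_continuous_image continuous_on_subset[OF assms(2)]) auto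
  moreover have "f z \<in> f ` K" for z
  proof -
    define b where "b = Im z / Im \<tau>"
    define a where "a = Re z - b * Re \<tau>"
    have z: "z = of_real a + of_real b * \<tau>"
      using assms(1) by (simp add: a_def b_def complex_eq_iff)
    define w where "w = - (of_int \<lfloor>a\<rfloor> + of_int \<lfloor>b\<rfloor> * \<tau>)"
    have "w \<in> lattice \<tau>" unfolding w_def using latticeI by (intro lattice_uminus)
    then have "f z = f (z + w)" using assms(3) by simp
    moreover have "z + w = of_real (frac a) + of_real (frac b) * \<tau>"
      by (simp add: z w_def frac_def algebra_simps)
    moreover have "(frac a, frac b) \<in> cbox (0, 0) (1, 1)"
      using frac_lt_1[of a] frac_lt_1[of b] by (auto simp: cbox_Pair_eq less_imp_le)
    ultimately show ?thesis unfolding K_def by (metis (mono_tags, lifting) image_eqI case_prod_conv)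
  qed
  ultimately show ?thesis
    by (meson bounded_subset image_subsetI)
qed

text \<open>
  Evenness rules out a simple pole, so the growth condition need only exclude a double one.
\<close>
theorem even_elliptic_constant:
  fixes f :: "complex \<Rightarrow> complex"
  assumes \<tau>: "Im \<tau> > 0" and holo: "f holomorphic_on - lattice \<tau>"
    and per1: "\<And>z. z \<notin> lattice \<tau> \<Longrightarrow> f (z + 1) = f z"
    and per2: "\<And>z. z \<notin> lattice \<tau> \<Longrightarrow> f (z + \<tau>) = f z"
    and even: "\<And>z. z \<notin> lattice \<tau> \<Longrightarrow> f (- z) = f z"
    and lim: "((\<lambda>z. z ^ 2 * f z) \<longlongrightarrow> 0) (at 0)"
  obtains C where "\<And>z. z \<notin> lattice \<tau> \<Longrightarrow> f z = C"
proof -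
  define e where "e = min 1 (Im \<tau>)"
  define U where "U = ball (0 :: complex) e"
  have e: "e > 0" using \<tau> by (simp add: e_def)
  have U: "z \<notin> lattice \<tau>" if "z \<in> U" "z \<noteq> 0" for z
    using lattice_discrete[OF \<tau>, of z] that by (auto simp: U_def e_def)
  have oU: "open U" and U0: "0 \<in> U" using e by (auto simp: U_def)
  \<comment> \<open>The growth hypothesis makes 0 the right value at the puncture, so the
    singularity of \<open>F\<close> is removable.\<close>
  define F where "F z = (if z = 0 then 0 else z ^ 2 * f z)" for z
  have F: "F holomorphic_on U"
  proof (rule no_isolated_singularity'[where K = "{0}"])
    have "(F \<longlongrightarrow> 0) (at 0)"
      by (rule Lim_transform_eventually[OF lim]) (auto simp: F_def eventually_at_filter)
    then show "(F \<longlongrightarrow> F z) (at z within U)" if "z \<in> {0}" for z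
      using that tendsto_within_subset by (fastforce simp: F_def)
    have "(\<lambda>z. z ^ 2 * f z) holomorphic_on U - {0}"
      by (intro holomorphic_intros holomorphic_on_subset[OF holo]) (use U in auto)
    then show "F holomorphic_on U - {0}"
      by (rule holomorphic_transform) (auto simp: F_def)
  qed (use oU in auto)
  have "(F has_field_derivative deriv F 0) (at 0)"
    using holomorphic_derivI[OF F oU U0] .
  \<comment> \<open>\<open>F\<close> inherits evenness from \<open>f\<close>, so its derivative at 0
    equals its own negative and vanishes.\<close>
  moreover have "((\<lambda>z. F (- z)) has_field_derivative - deriv F 0) (at 0)"
    using DERIV_chain'[of uminus "-1" 0 UNIV F "deriv F 0"] calculation
    by (simp add: DERIV_minus[OF DERIV_ident])
  moreover have "\<forall>\<^sub>F z in nhds 0. F (- z) = F z"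
    using eventually_nhds_in_open[OF oU U0]
    by eventually_elim (use U even in \<open>auto simp: F_def\<close>)
  ultimately have "(F has_field_derivative - deriv F 0) (at 0)"
    by (subst (asm) DERIV_cong_ev[where y = 0 and g = F]) auto
  then have dF: "deriv F 0 = 0"
    using DERIV_imp_deriv[of F "- deriv F 0" 0] by (simp add: eq_neg_iff_add_eq_0)
  \<comment> \<open>\<open>F\<close> vanishes to order two at 0; dividing by z twice leaves
    \<open>h\<close>, the holomorphic extension of \<open>f\<close> to 0.\<close>
  define F1 where "F1 z = (if z = 0 then deriv F 0 else (F z - F 0) / (z - 0))" for z
  have F1: "F1 holomorphic_on U"
    unfolding F1_def by (rule pole_lemma_open[OF F oU])
  define h where "h z = (if z = 0 then deriv F1 0 else (F1 z - F1 0) / (z - 0))" for z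
  have h: "h holomorphic_on U"
    unfolding h_def by (rule pole_lemma_open[OF F1 oU])
  have hf: "h z = f z" if "z \<in> U" "z \<noteq> 0" for z
    using that dF by (simp add: h_def F1_def F_def power2_eq_square)
  define G where "G z = (if z \<in> lattice \<tau> then h 0 else f z)" for z
  have "G field_differentiable at z" for z
  proof (cases "z \<in> lattice \<tau>")
    case False
    have "f field_differentiable at z"
      using holomorphic_on_imp_differentiable_at[OF holo open_compl_lattice[OF \<tau>]] False by auto
    moreover have "\<forall>\<^sub>F w in nhds z. w \<in> - lattice \<tau>"
      using open_compl_lattice[OF \<tau>] False by (intro eventually_nhds_in_open) auto
    then have "\<forall>\<^sub>F w in nhds z. f w = G w"
      by eventually_elim (simp add: G_def)
    ultimately show ?thesis
      using DERIV_cong_ev[of z z f G]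
      unfolding field_differentiable_def by blast
  next
    case True
    have "(h has_field_derivative deriv h 0) (at (z + - z))"
      using holomorphic_derivI[OF h oU U0] by simp
    then have "((\<lambda>w. h (w + - z)) has_field_derivative deriv h 0) (at z)"
      unfolding DERIV_shift .
    moreover have "\<forall>\<^sub>F w in nhds z. w \<in> ball z e"
      using e by (intro eventually_nhds_in_open) auto
    then have "\<forall>\<^sub>F w in nhds z. h (w + - z) = G w"
    proof eventually_elim
      case (elim w)
      have wz: "w - z \<in> U" using elim by (simp add: U_def dist_norm norm_minus_commute)
      show ?case
      proof (cases "w = z")
        case False
        then have nl: "w - z \<notin> lattice \<tau>" using U[OF wz] by simp
        have "w - z + z \<notin> lattice \<tau>" using nl True by (simp only: lattice_add_iff not_False_eq_True)
        then have "G w = f (w - z + z)" by (simp add: G_def)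
        also have "\<dots> = f (w - z)"
          by (rule lattice_periodic[OF per1 per2 True nl])
        finally show ?thesis using hf[OF wz] False by simp
      qed (use True in \<open>simp add: G_def\<close>)
    qed
    ultimately show ?thesis
      using DERIV_cong_ev[of z z "\<lambda>w. h (w + - z)" G] unfolding field_differentiable_def by blast
  qed
  then have G: "G holomorphic_on UNIV"
    by (simp add: holomorphic_on_def)
  have "bounded (range G)"
  proof (rule bounded_range_doubly_periodic[OF \<tau>])
    show "continuous_on UNIV G" using G by (rule holomorphic_on_imp_continuous_on)
    show "G (z + w) = G z" if "w \<in> lattice \<tau>" for z w
      using lattice_periodic[OF per1 per2 that, of z] that by (auto simp: G_def)
  qed
  with G obtain C where "\<And>z. G z = C"
    using Liouville_theorem unfolding constant_on_def by blast
  then show thesis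
    by (intro that[of C]) (metis G_def)
qed

section \<open>Series in the nome\<close>

definition c2pi :: complex where
  "c2pi = 2 * of_real pi * \<i>"

lemma c2pi_nonzero [simp]: "c2pi \<noteq> 0"
  by (simp add: c2pi_def)

definition nome :: "complex \<Rightarrow> complex" where
  "nome z = exp (c2pi * z)"

lemma nome_0 [simp]: "nome 0 = 1"
  by (simp add: nome_def)

lemma nome_add: "nome (z + w) = nome z * nome w"
  by (simp add: nome_def exp_add algebra_simps)

lemma nome_minus: "nome (- z) = inverse (nome z)"
  by (simp add: nome_def exp_minus)

lemma nome_nonzero [simp]: "nome z \<noteq> 0"
  by (simp add: nome_def)

lemma nome_1 [simp]: "nome 1 = 1"
  by (simp add: nome_def c2pi_def exp_two_pi_i)

lemma nome_half [simp]: "nome (1 / 2) = - 1"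
  by (simp add: nome_def c2pi_def)

lemma norm_nome: "norm (nome z) = exp (- (2 * pi * Im z))"
  by (simp add: nome_def c2pi_def)

lemma norm_nome_less_1 [simp]: "norm (nome z) < 1 \<longleftrightarrow> Im z > 0"
  by (simp add: norm_nome zero_less_mult_iff)

lemma nome_eq_1_iff: "nome z = 1 \<longleftrightarrow> (\<exists>m. z = of_int m)"
proof -
  have "nome z = 1 \<longleftrightarrow> Re (c2pi * z) = 0 \<and> (\<exists>m::int. Im (c2pi * z) = of_int (2 * m) * pi)"
    unfolding nome_def exp_eq_1 ..
  also have "\<dots> \<longleftrightarrow> (\<exists>m. z = of_int m)"
    by (auto simp: c2pi_def complex_eq_iff)
  finally show ?thesis .
qed

lemma nome_neq_1: "z \<notin> lattice \<tau> \<Longrightarrow> nome z \<noteq> 1"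
  using latticeI[of _ 0 \<tau>] by (auto simp: nome_eq_1_iff)

lemma nome_field_derivative [derivative_intros]:
  "(f has_field_derivative D) (at z within A) \<Longrightarrow>
     ((\<lambda>z. nome (f z)) has_field_derivative (c2pi * D * nome (f z))) (at z within A)"
  unfolding nome_def by (auto intro!: derivative_eq_intros)

lemma nome_tendsto [tendsto_intros]:
  "(f \<longlongrightarrow> l) F \<Longrightarrow> ((\<lambda>z. nome (f z)) \<longlongrightarrow> nome l) F"
  unfolding nome_def by (intro tendsto_intros)

text \<open>The condition \<open>a 0 = 0\<close> means decay towards \<i>\<infinity>, which is what
  allows the translates by multiples of \<tau> to be summed. Nothing is prescribed below the real
  axis, where \<open>f\<close> may have poles.\<close>

definition nome_series :: "(nat \<Rightarrow> complex) \<Rightarrow> (complex \<Rightarrow> complex) \<Rightarrow> bool" where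
  "nome_series a f \<longleftrightarrow> a 0 = 0 \<and> (\<forall>x. norm x < 1 \<longrightarrow> summable (\<lambda>k. a k * x ^ k)) \<and>
     (\<forall>z. Im z > 0 \<longrightarrow> f z = (\<Sum>k. a k * nome z ^ k))"

lemma nome_series_sums:
  "nome_series a f \<Longrightarrow> Im z > 0 \<Longrightarrow> (\<lambda>k. a k * nome z ^ k) sums f z"
  by (simp add: nome_series_def summable_sums)

lemma nome_series_derivative:
  assumes "nome_series a f"
  shows "nome_series (\<lambda>k. c2pi * of_nat k * a k) (deriv f)"
    and "Im z > 0 \<Longrightarrow> f field_differentiable at z"
proof -
  have sm: "\<And>x. norm x < 1 \<Longrightarrow> summable (\<lambda>k. a k * x ^ k)"
    using assms by (simp add: nome_series_def)
  have sums: "(\<lambda>k. of_nat k * a k * x ^ k) sums q_deriv (\<lambda>z. \<Sum>n. a n * z ^ n) x" if "norm x < 1" for x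
    by (rule q_deriv_power_series[OF sm that])
  have D: "(f has_field_derivative (\<Sum>k. c2pi * of_nat k * a k * nome z ^ k)) (at z)" if z: "Im z > 0" for z
  proof -
    have nz: "norm (nome z) < 1" using z by simp
    have "((\<lambda>x. \<Sum>k. a k * x ^ k) has_field_derivative (\<Sum>k. diffs a k * nome z ^ k)) (at (nome z))"
      by (rule termdiffs_strong'[OF sm nz])
    note this[folded DERIV_imp_deriv[OF this]]
    then have "((\<lambda>w. \<Sum>k. a k * nome w ^ k) has_field_derivative
        deriv (\<lambda>x. \<Sum>k. a k * x ^ k) (nome z) * (c2pi * 1 * nome z)) (at z)"
      by (rule DERIV_chain2) (intro nome_field_derivative DERIV_ident)
    moreover have "deriv (\<lambda>x. \<Sum>k. a k * x ^ k) (nome z) * (c2pi * 1 * nome z) =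
        (\<Sum>k. c2pi * of_nat k * a k * nome z ^ k)"
      using sums_unique[OF sums_mult[OF sums[OF nz], of c2pi]] by (simp add: q_deriv_def mult_ac)
    ultimately have "((\<lambda>w. \<Sum>k. a k * nome w ^ k) has_field_derivative
        (\<Sum>k. c2pi * of_nat k * a k * nome z ^ k)) (at z)"
      by simp
    moreover have "\<forall>\<^sub>F w in nhds z. w \<in> {w. Im w > 0}"
      using z by (intro eventually_nhds_in_open open_halfspace_Im_gt) auto
    then have "\<forall>\<^sub>F w in nhds z. (\<Sum>k. a k * nome w ^ k) = f w"
      by eventually_elim (use assms in \<open>simp add: nome_series_def\<close>)
    ultimately show ?thesis
      by (subst (asm) DERIV_cong_ev[where y = z and g = f]) auto
  qed
  have "summable (\<lambda>k. c2pi * (of_nat k * a k * x ^ k))" if "norm x < 1" for x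
    by (intro summable_mult) (use sums[OF that] sums_summable in blast)
  then show "nome_series (\<lambda>k. c2pi * of_nat k * a k) (deriv f)"
    using DERIV_imp_deriv[OF D] by (auto simp: nome_series_def mult_ac)
  show "f field_differentiable at z" if "Im z > 0"
    using D[OF that] field_differentiable_def by blast
qed

lemma nome_series_holomorphic: "nome_series a f \<Longrightarrow> f holomorphic_on {z. Im z > 0}"
  using nome_series_derivative(2)
  by (simp add: holomorphic_on_def field_differentiable_at_within)

lemma nome_series_higher_deriv:
  assumes "nome_series a f"
  shows "nome_series (\<lambda>k. (c2pi * of_nat k) ^ j * a k) ((deriv ^^ j) f)"
proof (induction j)
  case (Suc j)
  from nome_series_derivative(1)[OF this] show ?case by (simp add: mult_ac)
qed (use assms in simp)

text \<open>The solution g of g(z) - g(z + \<tau>) = f(z) that decays towards \<i>\<infinity>. On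
  nome coefficients it is division by 1 - q^k, so a geometric series becomes a Lambert
  series.\<close>

definition dsum :: "complex \<Rightarrow> (complex \<Rightarrow> complex) \<Rightarrow> complex \<Rightarrow> complex" where
  "dsum \<tau> f z = (\<Sum>n. f (z + of_nat n * \<tau>))"

lemma nome_add_of_nat: "nome (z + of_nat n * \<tau>) = nome \<tau> ^ n * nome z"
  by (induction n) (simp_all add: algebra_simps nome_add)

text \<open>The power series \<open>B\<close> with coefficients a_k / (1 - q^k) satisfies B(x) -
  B(qx) = f, so the sum over translates telescopes; continuity of \<open>B\<close> at 0 and
  \<open>B 0 = 0\<close> give the limit. No double series has to be rearranged.\<close>

lemma
  assumes f: "nome_series a f" and \<tau>: "Im \<tau> > 0"
  shows dsum_summable: "summable (\<lambda>n. f (z + of_nat n * \<tau>))"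
    and dsum_nome_series: "nome_series (\<lambda>k. a k / (1 - nome \<tau> ^ k)) (dsum \<tau> f)"
proof -
  define q where "q = nome \<tau>"
  define b where "b k = a k / (1 - q ^ k)" for k
  have q: "norm q < 1" using \<tau> by (simp add: q_def)
  have a0: "a 0 = 0" using f by (simp add: nome_series_def)
  have q1: "1 - norm q \<le> norm (1 - q ^ k)" if "k > 0" for k
  proof -
    have "norm (q ^ k) \<le> norm q ^ 1"
      unfolding norm_power using that q by (intro power_decreasing) auto
    then show ?thesis
      using norm_triangle_ineq2[of 1 "q ^ k"] by simp
  qed
  have sb: "summable (\<lambda>k. b k * x ^ k)" if x: "norm x < 1" for x
  proof (rule summable_comparison_test')
    define R where "R = (1 + norm x) / 2"
    have R: "norm x < R" "R < 1" using x by (auto simp: R_def)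
    have "summable (\<lambda>k. a k * of_real R ^ k)"
      using f R norm_ge_zero[of x] by (auto simp: nome_series_def simp del: norm_ge_zero)
    then have "summable (\<lambda>k. norm (a k * x ^ k))"
      by (rule powser_insidea) (use R norm_ge_zero[of x] in \<open>auto simp del: norm_ge_zero\<close>)
    then show "summable (\<lambda>k. norm (a k * x ^ k) / (1 - norm q))"
      by (rule summable_divide)
    show "norm (b k * x ^ k) \<le> norm (a k * x ^ k) / (1 - norm q)" for k
    proof (cases "k = 0")
      case False
      have "norm (a k * x ^ k) / norm (1 - q ^ k) \<le> norm (a k * x ^ k) / (1 - norm q)"
        using q1[of k] q False by (intro divide_left_mono mult_pos_pos) (auto intro: less_le_trans)
      then show ?thesis by (simp add: b_def norm_mult norm_divide)
    qed (simp add: b_def a0)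
  qed
  define B where "B x = (\<Sum>k. b k * x ^ k)" for x
  have B0: "B 0 = 0"
    unfolding B_def powser_zero by (simp add: b_def a0)
  have step: "f z = B (nome z) - B (nome (z + \<tau>))" if z: "Im z > 0" for z
  proof -
    have z': "norm (nome z) < 1" "norm (nome (z + \<tau>)) < 1"
      using z \<tau> by auto
    have "(\<lambda>k. b k * nome z ^ k - b k * nome (z + \<tau>) ^ k) sums (B (nome z) - B (nome (z + \<tau>)))"
      unfolding B_def using z' by (intro sums_diff summable_sums sb)
    moreover have "b k * nome z ^ k - b k * nome (z + \<tau>) ^ k = a k * nome z ^ k" for k
    proof (cases "k = 0")
      case False
      then have "1 - q ^ k \<noteq> 0" using q1[of k] q by auto
      then show ?thesis
        by (simp add: b_def nome_add power_mult_distrib flip: q_def) (simp add: divide_simps, simp add: algebra_simps)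
    qed (simp add: a0 b_def)
    ultimately show ?thesis
      using nome_series_sums[OF f z] by (simp add: sums_iff)
  qed
  have sums: "(\<lambda>n. f (z + of_nat n * \<tau>)) sums B (nome z)" if z: "Im z > 0" for z
  proof -
    have *: "Im (z + of_nat n * \<tau>) > 0" for n
      using z \<tau> by (simp add: add_pos_nonneg)
    have lim: "(\<lambda>n. nome \<tau> ^ n * nome z) \<longlonglongrightarrow> 0"
      using \<tau> by (intro tendsto_mult_left_zero LIMSEQ_power_zero) simp
    have "isCont B 0"
      unfolding B_def by (intro isCont_powser[of b "of_real (1/2)"] sb) auto
    from isCont_tendsto_compose[OF this lim]
    have "(\<lambda>n. B (nome (z + of_nat n * \<tau>))) \<longlonglongrightarrow> 0"
      by (simp add: B0 nome_add_of_nat)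
    from telescope_sums'[OF this]
    have "(\<lambda>n. B (nome (z + of_nat n * \<tau>)) - B (nome (z + of_nat (Suc n) * \<tau>))) sums B (nome z)"
      by simp
    moreover have "B (nome (z + of_nat n * \<tau>)) - B (nome (z + of_nat (Suc n) * \<tau>)) = f (z + of_nat n * \<tau>)" for n
      using step[OF *[of n]] by (simp add: algebra_simps)
    ultimately show ?thesis by (simp only:)
  qed
  \<comment> \<open>Only finitely many translates lie outside the upper half plane, so summability
    does not depend on the values of \<open>f\<close> there.\<close>
  obtain N :: nat where N: "real N > - Im z / Im \<tau>"
    using reals_Archimedean2 by blast
  have "Im (z + of_nat N * \<tau>) > 0"
    using N \<tau> by (simp add: field_simps)
  from sums_summable[OF sums[OF this]]
  have "summable (\<lambda>n. f (z + of_nat (n + N) * \<tau>))"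
    by (simp add: algebra_simps)
  then show "summable (\<lambda>n. f (z + of_nat n * \<tau>))"
    by (subst (asm) summable_iff_shift)
  show "nome_series (\<lambda>k. a k / (1 - nome \<tau> ^ k)) (dsum \<tau> f)"
    using sums sb a0 unfolding nome_series_def dsum_def B_def
    by (auto simp: sums_iff b_def q_def)
qed

lemma dsum_step:
  assumes "nome_series a f" "Im \<tau> > 0"
  shows "dsum \<tau> f z = f z + dsum \<tau> f (z + \<tau>)"
  using suminf_split_head[OF dsum_summable[OF assms, of z]]
  by (simp add: dsum_def algebra_simps)

lemma dsum_add_1: "(\<And>z. f (z + 1) = f z) \<Longrightarrow> dsum \<tau> f (z + 1) = dsum \<tau> f z"
  unfolding dsum_def by (metis (no_types, lifting) add.assoc add.commute)

text \<open>In the upper half plane the nome series gives holomorphy. The equation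
  \<open>dsum_step\<close> then continues the function downwards, one strip of height Im \<tau> per
  induction step, and each step adds only the singularities of \<open>f\<close>.\<close>

lemma dsum_holomorphic:
  assumes f: "nome_series a f" and \<tau>: "Im \<tau> > 0" and holo: "f holomorphic_on - lattice \<tau>"
  shows "dsum \<tau> f holomorphic_on - lattice \<tau>"
proof -
  have *: "dsum \<tau> f field_differentiable at z"
    if "z \<notin> lattice \<tau>" "Im z > - (of_nat n * Im \<tau>)" for z n
    using that
  proof (induction n arbitrary: z)
    case 0
    then show ?case
      using nome_series_derivative(2)[OF dsum_nome_series[OF f \<tau>]] by simp
  next
    case (Suc n)
    have "dsum \<tau> f field_differentiable at (z + \<tau>)"
    proof (rule Suc.IH)
      show "z + \<tau> \<notin> lattice \<tau>" using Suc.prems by simp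
      show "- (of_nat n * Im \<tau>) < Im (z + \<tau>)" using Suc.prems by (simp add: algebra_simps)
    qed
    then have "(\<lambda>z. dsum \<tau> f (z + \<tau>)) field_differentiable at z"
      unfolding field_differentiable_def DERIV_shift .
    moreover have "f field_differentiable at z"
      using holomorphic_on_imp_differentiable_at[OF holo open_compl_lattice[OF \<tau>]] Suc.prems by auto
    ultimately have "(\<lambda>z. f z + dsum \<tau> f (z + \<tau>)) field_differentiable at z"
      by (intro field_differentiable_add)
    moreover have "(\<lambda>z. f z + dsum \<tau> f (z + \<tau>)) = dsum \<tau> f"
      by (intro ext dsum_step[OF f \<tau>, symmetric])
    ultimately show ?case by (simp only:)
  qed
  have "dsum \<tau> f field_differentiable at z" if "z \<notin> lattice \<tau>" for z
  proof -
    obtain N :: nat where "real N > - Im z / Im \<tau>"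
      using reals_Archimedean2 by blast
    then have "Im z > - (of_nat N * Im \<tau>)"
      using \<tau> by (simp add: field_simps)
    from *[OF that this] show ?thesis .
  qed
  then show ?thesis
    by (simp add: holomorphic_on_def field_differentiable_at_within)
qed

section \<open>A zeta function of the lattice\<close>

text \<open>The geometric series in the nome; 1/2 + \<open>geo z\<close> is (\<i>/2) cot(\<pi> z),
  the odd function that the constant 1/2 in \<open>zeta_fn\<close> is there to complete.\<close>

definition geo :: "complex \<Rightarrow> complex" where
  "geo z = nome z / (1 - nome z)"

lemma geo_add_1 [simp]: "geo (z + 1) = geo z"
  by (simp add: geo_def nome_add)

lemma geo_minus: "nome z \<noteq> 1 \<Longrightarrow> geo (- z) = - 1 - geo z"
  by (simp add: geo_def nome_minus divide_simps)

lemma geo_nome_series: "nome_series (\<lambda>k. if k = 0 then 0 else 1) geo"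
proof -
  have "(\<lambda>k. (if k = 0 then 0 else 1) * x ^ k) sums (x / (1 - x))" if "norm x < 1" for x :: complex
  proof -
    have "(\<lambda>k. x * x ^ k) sums (x * (1 / (1 - x)))"
      by (intro sums_mult geometric_sums that)
    then show ?thesis
      using sums_Suc_iff[of "\<lambda>k. (if k = 0 then 0 else 1) * x ^ k" "x / (1 - x)"] by simp
  qed
  then show ?thesis
    by (auto simp: nome_series_def geo_def sums_iff)
qed

text \<open>This Riccati equation keeps every derivative of \<open>geo\<close> a polynomial in
  \<open>geo\<close>, so the computations at the pole and at 1/2 become algebra.\<close>

lemma geo_field_derivative:
  assumes "nome z \<noteq> 1"
  shows "(geo has_field_derivative c2pi * (geo z + geo z ^ 2)) (at z)"
proof -
  have "1 - nome z \<noteq> 0" using assms by simp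
  then have "(geo has_field_derivative
      ((c2pi * 1 * nome z) * (1 - nome z) - nome z * (0 - c2pi * 1 * nome z)) / ((1 - nome z) * (1 - nome z))) (at z)"
    unfolding geo_def[abs_def] by (intro DERIV_divide derivative_intros DERIV_ident)
  also have "((c2pi * 1 * nome z) * (1 - nome z) - nome z * (0 - c2pi * 1 * nome z)) / ((1 - nome z) * (1 - nome z))
      = c2pi * (geo z + geo z ^ 2)"
    using \<open>1 - nome z \<noteq> 0\<close>
    by (simp add: geo_def divide_simps power2_eq_square) (simp add: algebra_simps)
  finally show ?thesis .
qed

lemma geo_holomorphic: "geo holomorphic_on - lattice \<tau>"
proof (rule holomorphic_onI)
  fix z assume "z \<in> - lattice \<tau>"
  then have "nome z \<noteq> 1" using nome_neq_1 by auto
  from has_field_derivative_at_within[OF geo_field_derivative[OF this]]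
  show "geo field_differentiable at z within - lattice \<tau>"
    unfolding field_differentiable_def by blast
qed

text \<open>The residue at 0, which is the source of the factor \<open>- c2pi\<close> between
  \<open>zeta_fn\<close> and the Weierstrass zeta function.\<close>

lemma geo_tendsto_0: "((\<lambda>z. z * geo z) \<longlongrightarrow> - 1 / c2pi) (at 0)"
proof -
  have "(nome has_field_derivative c2pi) (at 0)"
    using nome_field_derivative[OF DERIV_ident, of 0 UNIV] by simp
  then have "((\<lambda>z. (nome z - 1) / z) \<longlongrightarrow> c2pi) (at 0)"
    by (simp add: has_field_derivative_iff)
  then have "((\<lambda>z. - nome z / ((nome z - 1) / z)) \<longlongrightarrow> - nome 0 / c2pi) (at 0)"
    by (intro tendsto_intros) auto
  moreover have "- nome z / ((nome z - 1) / z) = z * geo z" for z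
    by (cases "nome z = 1") (simp_all add: geo_def divide_simps, simp_all add: algebra_simps)
  ultimately show ?thesis by simp
qed

definition lambert_fn :: "complex \<Rightarrow> complex \<Rightarrow> complex" where
  "lambert_fn \<tau> = dsum \<tau> geo"

definition lambert_fn2 :: "complex \<Rightarrow> complex \<Rightarrow> complex" where
  "lambert_fn2 \<tau> = dsum \<tau> (lambert_fn \<tau>)"

text \<open>
  \<open>zeta_fn\<close> is the Weierstrass zeta function divided by \<open>- c2pi\<close> and corrected by a linear term that makes
  its quasi-periods along \<open>1\<close> and \<open>\<tau>\<close> equal to \<open>0\<close> and \<open>1\<close>.
\<close>

definition zeta_fn :: "complex \<Rightarrow> complex \<Rightarrow> complex" where
  "zeta_fn \<tau> z = 1 / 2 + lambert_fn \<tau> z - lambert_fn \<tau> (\<tau> - z)"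

text \<open>\<open>c2pi * wp_fn \<tau>\<close> is the Weierstrass function of the lattice up to an
  additive constant, the derivative of the linear correction in \<open>zeta_fn\<close>.\<close>

definition wp_fn :: "complex \<Rightarrow> complex \<Rightarrow> complex" where
  "wp_fn \<tau> = deriv (zeta_fn \<tau>)"

text \<open>
  The expansion of \<open>lambert_sq_fn\<close> at \<open>1 / 2\<close> carries the coefficients \<open>q\<^sup>n / (1 - q\<^sup>n)\<^sup>2\<close> of the derivatives of the
  Lambert series.
\<close>

definition lambert_sq_fn :: "complex \<Rightarrow> complex \<Rightarrow> complex" where
  "lambert_sq_fn \<tau> z = lambert_fn2 \<tau> (\<tau> + z) + lambert_fn2 \<tau> (\<tau> - z)"

lemma lambert_fn_nome_series: "Im \<tau> > 0 \<Longrightarrow> nome_series (\<lambda>k. (if k = 0 then 0 else 1) / (1 - nome \<tau> ^ k)) (lambert_fn \<tau>)"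
  unfolding lambert_fn_def by (intro dsum_nome_series geo_nome_series)

lemma lambert_fn2_nome_series:
  "Im \<tau> > 0 \<Longrightarrow> nome_series (\<lambda>k. (if k = 0 then 0 else 1) / (1 - nome \<tau> ^ k) / (1 - nome \<tau> ^ k)) (lambert_fn2 \<tau>)"
  unfolding lambert_fn2_def by (intro dsum_nome_series lambert_fn_nome_series)

lemma lambert_fn_add_1 [simp]: "lambert_fn \<tau> (z + 1) = lambert_fn \<tau> z"
  unfolding lambert_fn_def by (intro dsum_add_1) simp

lemma lambert_fn2_add_1 [simp]: "lambert_fn2 \<tau> (z + 1) = lambert_fn2 \<tau> z"
  unfolding lambert_fn2_def by (intro dsum_add_1) simp

lemma lambert_fn_step: "Im \<tau> > 0 \<Longrightarrow> lambert_fn \<tau> z = geo z + lambert_fn \<tau> (z + \<tau>)"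
  unfolding lambert_fn_def by (rule dsum_step[OF geo_nome_series])

lemma lambert_fn2_step: "Im \<tau> > 0 \<Longrightarrow> lambert_fn2 \<tau> z = lambert_fn \<tau> z + lambert_fn2 \<tau> (z + \<tau>)"
  unfolding lambert_fn2_def by (rule dsum_step[OF lambert_fn_nome_series])

lemma lambert_fn_holomorphic: "Im \<tau> > 0 \<Longrightarrow> lambert_fn \<tau> holomorphic_on - lattice \<tau>"
  unfolding lambert_fn_def by (intro dsum_holomorphic[OF geo_nome_series] geo_holomorphic)

lemma lambert_fn2_holomorphic: "Im \<tau> > 0 \<Longrightarrow> lambert_fn2 \<tau> holomorphic_on - lattice \<tau>"
  unfolding lambert_fn2_def by (intro dsum_holomorphic[OF lambert_fn_nome_series] lambert_fn_holomorphic)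

lemma holomorphic_on_compose_lattice:
  fixes f :: "complex \<Rightarrow> complex"
  assumes "f holomorphic_on - lattice \<tau>" "g holomorphic_on A" "\<And>z. z \<in> A \<Longrightarrow> g z \<notin> lattice \<tau>"
  shows "(\<lambda>z. f (g z)) holomorphic_on A"
  using holomorphic_on_compose_gen[OF assms(2,1)] assms(3) by (auto simp: o_def)

lemma zeta_holomorphic: "Im \<tau> > 0 \<Longrightarrow> zeta_fn \<tau> holomorphic_on - lattice \<tau>"
  unfolding zeta_fn_def[abs_def]
  by (intro holomorphic_intros lambert_fn_holomorphic holomorphic_on_compose_lattice[OF lambert_fn_holomorphic]) auto

lemma lambert_sq_holomorphic: "Im \<tau> > 0 \<Longrightarrow> lambert_sq_fn \<tau> holomorphic_on - lattice \<tau>"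
  unfolding lambert_sq_fn_def[abs_def]
  by (intro holomorphic_intros holomorphic_on_compose_lattice[OF lambert_fn2_holomorphic])
    (auto simp: add.commute[of \<tau>])

lemma zeta_add_1: "zeta_fn \<tau> (z + 1) = zeta_fn \<tau> z"
  using lambert_fn_add_1[of \<tau> "\<tau> - (z + 1)"] by (simp add: zeta_fn_def)

text \<open>Passing from z to z + \<tau> drops \<open>geo z\<close> from the forward sum and adds
  \<open>geo (- z)\<close> to the backward one; the reflection geo(-z) + geo(z) = -1 produces the
  quasi-period 1, and the summand 1/2 is what makes \<open>zeta_fn\<close> odd.\<close>

lemma
  assumes "Im \<tau> > 0" "z \<notin> lattice \<tau>"
  shows zeta_add_tau: "zeta_fn \<tau> (z + \<tau>) = zeta_fn \<tau> z + 1"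
    and zeta_minus: "zeta_fn \<tau> (- z) = - zeta_fn \<tau> z"
    and lambert_sq_add_tau: "lambert_sq_fn \<tau> (z + \<tau>) = lambert_sq_fn \<tau> z - zeta_fn \<tau> z - 1 / 2"
proof -
  have 1: "lambert_fn \<tau> (- z) = geo (- z) + lambert_fn \<tau> (\<tau> - z)" and 2: "lambert_fn \<tau> z = geo z + lambert_fn \<tau> (z + \<tau>)"
    using lambert_fn_step[OF assms(1), of z] lambert_fn_step[OF assms(1), of "- z"] by simp_all
  have 3: "geo (- z) = - 1 - geo z"
    using assms by (intro geo_minus nome_neq_1)
  have 4: "lambert_fn2 \<tau> (- z) = lambert_fn \<tau> (- z) + lambert_fn2 \<tau> (\<tau> - z)" "lambert_fn2 \<tau> (z + \<tau>) = lambert_fn \<tau> (z + \<tau>) + lambert_fn2 \<tau> (\<tau> + (z + \<tau>))"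
    using lambert_fn2_step[OF assms(1), of "z + \<tau>"] lambert_fn2_step[OF assms(1), of "- z"] by (simp_all add: algebra_simps)
  show "zeta_fn \<tau> (z + \<tau>) = zeta_fn \<tau> z + 1"
    by (simp add: zeta_fn_def 1 2 3 add.commute[of \<tau> z])
  show "zeta_fn \<tau> (- z) = - zeta_fn \<tau> z"
    by (simp add: zeta_fn_def 1 2 3 add.commute[of \<tau> z])
  show "lambert_sq_fn \<tau> (z + \<tau>) = lambert_sq_fn \<tau> z - zeta_fn \<tau> z - 1 / 2"
    by (simp add: zeta_fn_def lambert_sq_fn_def 1 2 3 4 add.commute[of \<tau> z])
qed

lemma lambert_sq_add_1: "lambert_sq_fn \<tau> (z + 1) = lambert_sq_fn \<tau> z"
  using lambert_fn2_add_1[of \<tau> "\<tau> - (z + 1)"] lambert_fn2_add_1[of \<tau> "\<tau> + z"] by (simp add: lambert_sq_fn_def algebra_simps)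

lemma lambert_sq_minus: "lambert_sq_fn \<tau> (- z) = lambert_sq_fn \<tau> z"
  by (simp add: lambert_sq_fn_def)

lemma deriv_quasi_periodic:
  assumes "Im \<tau> > 0" "f holomorphic_on - lattice \<tau>" "w \<in> lattice \<tau>" "z \<notin> lattice \<tau>"
    and "\<And>z. z \<notin> lattice \<tau> \<Longrightarrow> f (z + w) = f z + b"
  shows "deriv f (z + w) = deriv f z"
proof -
  have o: "open (- lattice \<tau>)" using assms open_compl_lattice by blast
  have "(f has_field_derivative deriv f (z + w)) (at (z + w))"
    using assms by (intro holomorphic_derivI[OF assms(2) o]) auto
  then have "((\<lambda>z. f (z + w)) has_field_derivative deriv f (z + w)) (at z)"
    by (simp add: DERIV_shift)
  moreover have "\<forall>\<^sub>F z in nhds z. z \<in> - lattice \<tau>"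
    using o assms by (intro eventually_nhds_in_open) auto
  then have "\<forall>\<^sub>F z in nhds z. f (z + w) = f z + b"
    by eventually_elim (use assms in simp)
  ultimately have "((\<lambda>z. f z + b) has_field_derivative deriv f (z + w)) (at z)"
    by (subst (asm) DERIV_cong_ev[where y = z and g = "\<lambda>z. f z + b"]) auto
  moreover have "((\<lambda>z. f z + b) has_field_derivative deriv f z + 0) (at z)"
    using assms by (intro derivative_intros holomorphic_derivI[OF assms(2) o]) auto
  ultimately show ?thesis
    using DERIV_unique by fastforce
qed

text \<open>With a = -1 this passes parity from a function to its derivative.\<close>

lemma deriv_homogeneous:
  assumes "Im \<tau> > 0" "f holomorphic_on - lattice \<tau>" "z \<notin> lattice \<tau>"
    and "\<And>z. a * z \<in> lattice \<tau> \<longleftrightarrow> z \<in> lattice \<tau>"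
    and "\<And>z. z \<notin> lattice \<tau> \<Longrightarrow> f (a * z) = b * f z"
  shows "a * deriv f (a * z) = b * deriv f z"
proof -
  have o: "open (- lattice \<tau>)" using assms open_compl_lattice by blast
  have "((\<lambda>z. f (a * z)) has_field_derivative deriv f (a * z) * (a * 1)) (at z)"
    using assms by (intro DERIV_chain2[where f = f] DERIV_cmult DERIV_ident holomorphic_derivI[OF assms(2) o]) auto
  moreover have "\<forall>\<^sub>F z in nhds z. z \<in> - lattice \<tau>"
    using o assms by (intro eventually_nhds_in_open) auto
  then have "\<forall>\<^sub>F z in nhds z. f (a * z) = b * f z"
    by eventually_elim (use assms in simp)
  ultimately have "((\<lambda>z. b * f z) has_field_derivative deriv f (a * z) * (a * 1)) (at z)"
    by (subst (asm) DERIV_cong_ev[where y = z and g = "\<lambda>z. b * f z"]) auto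
  moreover have "((\<lambda>z. b * f z) has_field_derivative b * deriv f z) (at z)"
    using assms by (intro DERIV_cmult holomorphic_derivI[OF assms(2) o]) auto
  ultimately show ?thesis
    using DERIV_unique by fastforce
qed

lemma wp_holomorphic: "Im \<tau> > 0 \<Longrightarrow> wp_fn \<tau> holomorphic_on - lattice \<tau>"
  unfolding wp_fn_def by (intro holomorphic_deriv zeta_holomorphic open_compl_lattice)

lemma
  assumes "Im \<tau> > 0" "z \<notin> lattice \<tau>"
  shows wp_add_1: "wp_fn \<tau> (z + 1) = wp_fn \<tau> z"
    and wp_add_tau: "wp_fn \<tau> (z + \<tau>) = wp_fn \<tau> z"
    and wp_minus: "wp_fn \<tau> (- z) = wp_fn \<tau> z"
  using deriv_quasi_periodic[OF assms(1) zeta_holomorphic one_in_lattice assms(2), of 0]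
    deriv_quasi_periodic[OF assms(1) zeta_holomorphic tau_in_lattice assms(2), of 1]
    deriv_homogeneous[OF assms(1) zeta_holomorphic assms(2), of "-1" "-1"] assms
  by (simp_all add: wp_fn_def zeta_add_1 zeta_add_tau zeta_minus)

section \<open>Behaviour at the origin and the elliptic identities\<close>

definition strip :: "complex \<Rightarrow> complex set" where
  "strip \<tau> = {z. \<bar>Im z\<bar> < Im \<tau>}"

lemma open_strip: "open (strip \<tau>)"
proof -
  have "strip \<tau> = {z. Im z < Im \<tau>} \<inter> {z. Im z > - Im \<tau>}"
    by (auto simp: strip_def)
  then show ?thesis
    by (simp add: open_Int open_halfspace_Im_gt open_halfspace_Im_lt)
qed

lemma zero_in_strip [simp]: "Im \<tau> > 0 \<Longrightarrow> 0 \<in> strip \<tau>"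
  by (simp add: strip_def)

text \<open>The part of \<open>zeta_fn\<close> that is regular throughout the strip, the poles being those of \<open>geo\<close>.\<close>

definition zeta_reg :: "complex \<Rightarrow> complex \<Rightarrow> complex" where
  "zeta_reg \<tau> z = lambert_fn \<tau> (z + \<tau>) - lambert_fn \<tau> (\<tau> - z)"

lemma holomorphic_on_strip:
  assumes "nome_series a f"
  shows "(\<lambda>z. f (\<tau> + z)) holomorphic_on strip \<tau>" "(\<lambda>z. f (z + \<tau>)) holomorphic_on strip \<tau>"
    "(\<lambda>z. f (\<tau> - z)) holomorphic_on strip \<tau>"
proof -
  have f: "f holomorphic_on {z. Im z > 0}"
    by (rule nome_series_holomorphic[OF assms])
  have "(\<lambda>z. f (u * z + \<tau>)) holomorphic_on strip \<tau>" if "u = 1 \<or> u = - 1" for u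
    using that by (intro holomorphic_on_compose_gen[OF _ f, unfolded o_def] holomorphic_intros) (auto simp: strip_def)
  from this[of 1] this[of "-1"] show "(\<lambda>z. f (\<tau> + z)) holomorphic_on strip \<tau>"
    "(\<lambda>z. f (z + \<tau>)) holomorphic_on strip \<tau>" "(\<lambda>z. f (\<tau> - z)) holomorphic_on strip \<tau>"
    by (simp_all add: add.commute)
qed

lemma zeta_reg_holomorphic: "Im \<tau> > 0 \<Longrightarrow> zeta_reg \<tau> holomorphic_on strip \<tau>"
  unfolding zeta_reg_def[abs_def]
  by (intro holomorphic_intros holomorphic_on_strip[OF lambert_fn_nome_series])

lemma zeta_eq: "Im \<tau> > 0 \<Longrightarrow> zeta_fn \<tau> z = 1 / 2 + geo z + zeta_reg \<tau> z"
  using lambert_fn_step[of \<tau> z] by (simp add: zeta_fn_def zeta_reg_def)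

text \<open>Both arguments \<tau> + z and \<tau> - z stay in the upper half plane, so this function
  is regular at 0 and the pole there in Ramanujan's identity comes from \<open>zeta_fn\<close> and
  \<open>wp_fn\<close> alone.\<close>

lemma lambert_sq_holomorphic_strip: "Im \<tau> > 0 \<Longrightarrow> lambert_sq_fn \<tau> holomorphic_on strip \<tau>"
  unfolding lambert_sq_fn_def[abs_def]
  by (intro holomorphic_intros holomorphic_on_strip[OF lambert_fn2_nome_series])

lemma has_field_derivative_cong_open:
  assumes "open S" "z \<in> S" "\<And>w. w \<in> S \<Longrightarrow> f w = g w" "(g has_field_derivative D) (at z)"
  shows "(f has_field_derivative D) (at z)"
proof -
  have "\<forall>\<^sub>F w in nhds z. w \<in> S"
    using assms by (intro eventually_nhds_in_open) auto
  then have "\<forall>\<^sub>F w in nhds z. f w = g w"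
    by eventually_elim (use assms in auto)
  then show ?thesis
    using assms(4) by (subst DERIV_cong_ev[where y = z and g = g]) auto
qed

text \<open>With g = geo + geo^2 the Riccati equation gives geo' = c2pi g and g'' = c2pi^2 (1 + 6g)
  g, the differential equation of the degenerate, trigonometric \<wp>; the regular part is merely
  carried along.\<close>

lemma
  assumes \<tau>: "Im \<tau> > 0" and z: "z \<in> strip \<tau> - lattice \<tau>"
  shows wp_eq: "wp_fn \<tau> z = c2pi * (geo z + geo z ^ 2) + deriv (zeta_reg \<tau>) z"
    and wp_deriv2_eq: "(deriv ^^ 2) (wp_fn \<tau>) z =
      c2pi ^ 3 * ((1 + 6 * geo z + 6 * geo z ^ 2) * (geo z + geo z ^ 2)) + (deriv ^^ 3) (zeta_reg \<tau>) z"
proof -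
  let ?S = "strip \<tau> - lattice \<tau>"
  have S: "open ?S"
    by (intro open_Diff open_strip closed_lattice \<tau>)
  have geo: "(geo has_field_derivative c2pi * (geo w + geo w ^ 2)) (at w)" if "w \<in> ?S" for w
    using that by (intro geo_field_derivative nome_neq_1) auto
  have reg: "((deriv ^^ n) (zeta_reg \<tau>) has_field_derivative (deriv ^^ Suc n) (zeta_reg \<tau>) w) (at w)"
    if "w \<in> ?S" for n w
    using that zeta_reg_holomorphic[OF \<tau>] open_strip
    by (intro has_field_derivative_higher_deriv) auto
  have 1: "wp_fn \<tau> w = c2pi * (geo w + geo w ^ 2) + deriv (zeta_reg \<tau>) w" if w: "w \<in> ?S" for w
    unfolding wp_fn_def
    by (intro DERIV_imp_deriv has_field_derivative_cong_open[OF S w zeta_eq[OF \<tau>]])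
      (use geo[OF w] reg[OF w, of 0] in \<open>auto intro!: derivative_eq_intros\<close>)
  have 2: "deriv (wp_fn \<tau>) w =
      c2pi ^ 2 * (geo w + 3 * geo w ^ 2 + 2 * geo w ^ 3) + (deriv ^^ 2) (zeta_reg \<tau>) w" if w: "w \<in> ?S" for w
    by (intro DERIV_imp_deriv has_field_derivative_cong_open[OF S w 1])
      (use geo[OF w] reg[OF w, of 1] in
        \<open>auto intro!: derivative_eq_intros simp: algebra_simps power2_eq_square power3_eq_cube numeral_2_eq_2\<close>)
  have 3: "(deriv ^^ 2) (wp_fn \<tau>) w =
      c2pi ^ 3 * ((1 + 6 * geo w + 6 * geo w ^ 2) * (geo w + geo w ^ 2)) + (deriv ^^ 3) (zeta_reg \<tau>) w"
    if w: "w \<in> ?S" for w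
  proof -
    have "deriv (deriv (wp_fn \<tau>)) w =
      c2pi ^ 3 * ((1 + 6 * geo w + 6 * geo w ^ 2) * (geo w + geo w ^ 2)) + (deriv ^^ 3) (zeta_reg \<tau>) w"
      by (intro DERIV_imp_deriv has_field_derivative_cong_open[OF S w 2])
        (use geo[OF w] reg[OF w, of 2] in
          \<open>auto intro!: derivative_eq_intros simp: algebra_simps power2_eq_square power3_eq_cube numeral_3_eq_3 numeral_2_eq_2\<close>)
    then show ?thesis by (simp add: numeral_2_eq_2)
  qed
  show "wp_fn \<tau> z = c2pi * (geo z + geo z ^ 2) + deriv (zeta_reg \<tau>) z"
    "(deriv ^^ 2) (wp_fn \<tau>) z =
      c2pi ^ 3 * ((1 + 6 * geo z + 6 * geo z ^ 2) * (geo z + geo z ^ 2)) + (deriv ^^ 3) (zeta_reg \<tau>) z"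
    using 1 3 z by blast+
qed

lemma eventually_in_strip_diff_lattice:
  assumes \<tau>: "Im \<tau> > 0"
  shows "\<forall>\<^sub>F z in at 0. z \<in> strip \<tau> - lattice \<tau>"
proof -
  have "\<forall>\<^sub>F z in at 0. z \<in> strip \<tau>"
    using open_strip zero_in_strip[OF \<tau>] by (rule eventually_at_in_open')
  moreover have "\<forall>\<^sub>F z in at 0. z \<in> ball 0 (min 1 (Im \<tau>)) - {0}"
    using \<tau> by (intro eventually_at_in_open) auto
  ultimately show ?thesis
    by eventually_elim (use lattice_discrete[OF \<tau>] in auto)
qed

lemma holomorphic_tendsto_0:
  assumes "Im \<tau> > 0" "f holomorphic_on strip \<tau>"
  shows "(f \<longlongrightarrow> f 0) (at 0)"
proof -
  have "continuous_on (strip \<tau>) f"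
    using assms by (simp add: holomorphic_on_imp_continuous_on)
  then show ?thesis
    using assms open_strip zero_in_strip by (simp add: continuous_on_eq_continuous_at isCont_def)
qed

lemma zeta_reg_deriv_tendsto:
  "Im \<tau> > 0 \<Longrightarrow> ((deriv ^^ n) (zeta_reg \<tau>) \<longlongrightarrow> (deriv ^^ n) (zeta_reg \<tau>) 0) (at 0)"
  by (rule holomorphic_tendsto_0[OF _ holomorphic_higher_deriv[OF zeta_reg_holomorphic open_strip]])

lemma geo_square_tendsto_0:
  "((\<lambda>z. z ^ 2 * geo z) \<longlongrightarrow> 0) (at 0)" "((\<lambda>z. z ^ 2 * geo z ^ 2) \<longlongrightarrow> 1 / c2pi ^ 2) (at 0)"
proof -
  have "((\<lambda>z. z * (z * geo z)) \<longlongrightarrow> 0 * (- 1 / c2pi)) (at 0)"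
    by (intro tendsto_intros geo_tendsto_0)
  then show "((\<lambda>z. z ^ 2 * geo z) \<longlongrightarrow> 0) (at 0)"
    by (simp add: power2_eq_square mult_ac)
  have "((\<lambda>z. (z * geo z) ^ 2) \<longlongrightarrow> (- 1 / c2pi) ^ 2) (at 0)"
    by (intro tendsto_intros geo_tendsto_0)
  then show "((\<lambda>z. z ^ 2 * geo z ^ 2) \<longlongrightarrow> 1 / c2pi ^ 2) (at 0)"
    by (simp add: power_mult_distrib power_divide)
qed

lemma wp_tendsto_0:
  assumes \<tau>: "Im \<tau> > 0"
  shows "((\<lambda>z. z ^ 2 * wp_fn \<tau> z) \<longlongrightarrow> 1 / c2pi) (at 0)"
proof (rule Lim_transform_eventually)
  have "((\<lambda>z. c2pi * (z ^ 2 * geo z + z ^ 2 * geo z ^ 2) + z ^ 2 * (deriv ^^ 1) (zeta_reg \<tau>) z) \<longlongrightarrow>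
      c2pi * (0 + 1 / c2pi ^ 2) + 0 ^ 2 * (deriv ^^ 1) (zeta_reg \<tau>) 0) (at 0)"
    by (intro tendsto_intros geo_square_tendsto_0 zeta_reg_deriv_tendsto \<tau>)
  then show "((\<lambda>z. c2pi * (z ^ 2 * geo z + z ^ 2 * geo z ^ 2) + z ^ 2 * (deriv ^^ 1) (zeta_reg \<tau>) z) \<longlongrightarrow>
      1 / c2pi) (at 0)"
    by (simp add: power2_eq_square)
  show "\<forall>\<^sub>F z in at 0. c2pi * (z ^ 2 * geo z + z ^ 2 * geo z ^ 2) + z ^ 2 * (deriv ^^ 1) (zeta_reg \<tau>) z =
      z ^ 2 * wp_fn \<tau> z"
    using eventually_in_strip_diff_lattice[OF \<tau>]
    by eventually_elim (simp add: wp_eq[OF \<tau>] algebra_simps)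
qed

text \<open>Under z to z + \<tau> the square of \<open>zeta_fn\<close> grows by 2
  \<open>zeta_fn\<close> + 1, which twice \<open>lambert_sq_fn\<close> takes back. At 0 the square
  and \<open>wp_fn \<tau> z / c2pi\<close> have the same double pole.\<close>

theorem zeta_square_identity:
  assumes \<tau>: "Im \<tau> > 0"
  obtains C where "\<And>z. z \<notin> lattice \<tau> \<Longrightarrow> zeta_fn \<tau> z ^ 2 + 2 * lambert_sq_fn \<tau> z - wp_fn \<tau> z / c2pi = C"
proof (rule even_elliptic_constant[OF \<tau>, of "\<lambda>z. zeta_fn \<tau> z ^ 2 + 2 * lambert_sq_fn \<tau> z - wp_fn \<tau> z / c2pi"])
  show "(\<lambda>z. zeta_fn \<tau> z ^ 2 + 2 * lambert_sq_fn \<tau> z - wp_fn \<tau> z / c2pi) holomorphic_on - lattice \<tau>"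
    by (intro holomorphic_intros zeta_holomorphic lambert_sq_holomorphic wp_holomorphic \<tau>) auto
  show "((\<lambda>z. z ^ 2 * (zeta_fn \<tau> z ^ 2 + 2 * lambert_sq_fn \<tau> z - wp_fn \<tau> z / c2pi)) \<longlongrightarrow> 0) (at 0)"
  proof (rule Lim_transform_eventually)
    let ?H = "(deriv ^^ 0) (zeta_reg \<tau>)" and ?H' = "(deriv ^^ 1) (zeta_reg \<tau>)"
    \<comment> \<open>Here \<open>geo z + geo z ^ 2\<close> has already cancelled: it occurs in the
      square of 1/2 + geo and also in \<open>wp_fn \<tau> z / c2pi\<close>.\<close>
    let ?f = "\<lambda>z. z ^ 2 / 4 + 2 * (z ^ 2 * geo z) * ?H z + z ^ 2 * (?H z + ?H z ^ 2 + 2 * lambert_sq_fn \<tau> z - ?H' z / c2pi)"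
    have "(?f \<longlongrightarrow> 0 ^ 2 / 4 + 2 * 0 * ?H 0 + 0 ^ 2 * (?H 0 + ?H 0 ^ 2 + 2 * lambert_sq_fn \<tau> 0 - ?H' 0 / c2pi)) (at 0)"
      by (intro tendsto_intros geo_square_tendsto_0 zeta_reg_deriv_tendsto \<tau>
          holomorphic_tendsto_0[OF \<tau> lambert_sq_holomorphic_strip]) auto
    then show "(?f \<longlongrightarrow> 0) (at 0)" by simp
    show "\<forall>\<^sub>F z in at 0. ?f z = z ^ 2 * (zeta_fn \<tau> z ^ 2 + 2 * lambert_sq_fn \<tau> z - wp_fn \<tau> z / c2pi)"
      using eventually_in_strip_diff_lattice[OF \<tau>]
      by eventually_elim
        (simp add: wp_eq[OF \<tau>] zeta_eq[OF \<tau>] add_divide_distrib, simp add: algebra_simps power2_eq_square)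
  qed
  show "zeta_fn \<tau> (z + 1) ^ 2 + 2 * lambert_sq_fn \<tau> (z + 1) - wp_fn \<tau> (z + 1) / c2pi =
      zeta_fn \<tau> z ^ 2 + 2 * lambert_sq_fn \<tau> z - wp_fn \<tau> z / c2pi" if "z \<notin> lattice \<tau>" for z
    unfolding zeta_add_1 lambert_sq_add_1 wp_add_1[OF \<tau> that] ..
  show "zeta_fn \<tau> (z + \<tau>) ^ 2 + 2 * lambert_sq_fn \<tau> (z + \<tau>) - wp_fn \<tau> (z + \<tau>) / c2pi =
      zeta_fn \<tau> z ^ 2 + 2 * lambert_sq_fn \<tau> z - wp_fn \<tau> z / c2pi" if "z \<notin> lattice \<tau>" for z
    unfolding zeta_add_tau[OF \<tau> that] lambert_sq_add_tau[OF \<tau> that] wp_add_tau[OF \<tau> that]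
    by (simp add: power2_eq_square algebra_simps)
  show "zeta_fn \<tau> (- z) ^ 2 + 2 * lambert_sq_fn \<tau> (- z) - wp_fn \<tau> (- z) / c2pi =
      zeta_fn \<tau> z ^ 2 + 2 * lambert_sq_fn \<tau> z - wp_fn \<tau> z / c2pi" if "z \<notin> lattice \<tau>" for z
    unfolding zeta_minus[OF \<tau> that] lambert_sq_minus wp_minus[OF \<tau> that] by simp
qed (rule that)

text \<open>The fourth-order poles cancel because the trigonometric part satisfies the equation with
  the same leading coefficient; the linear term then removes the remaining double pole.
  \<open>A\<close> and \<open>B\<close> stay unspecified here and are determined later from
  derivatives at 1/2.\<close>

theorem wp_ode:
  assumes \<tau>: "Im \<tau> > 0"
  obtains A B where "\<And>z. z \<notin> lattice \<tau> \<Longrightarrow> (deriv ^^ 2) (wp_fn \<tau>) z = 6 * c2pi * wp_fn \<tau> z ^ 2 + A * wp_fn \<tau> z + B"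
proof -
  define R where "R z = (deriv ^^ 1) (zeta_reg \<tau>) z / c2pi" for z
  \<comment> \<open>Substituting wp = c2pi (g + R), the coefficient of g in \<open>f\<close> is 1 -
    12 R - k; this choice makes it vanish at 0.\<close>
  define k where "k = 1 - 12 * R 0"
  define f where "f z = (deriv ^^ 2) (wp_fn \<tau>) z / c2pi ^ 3 - 6 * wp_fn \<tau> z ^ 2 / c2pi ^ 2 - k * wp_fn \<tau> z / c2pi" for z
  note o = open_compl_lattice[OF \<tau>]
  have hd: "deriv (wp_fn \<tau>) holomorphic_on - lattice \<tau>"
    by (intro holomorphic_deriv wp_holomorphic \<tau> o)
  have dper: "deriv (deriv (wp_fn \<tau>)) (z + w) = deriv (deriv (wp_fn \<tau>)) z"
    if "w \<in> lattice \<tau>" "z \<notin> lattice \<tau>" for z w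
    by (rule deriv_quasi_periodic[OF \<tau> hd that, of 0], unfold add_0_right,
        rule deriv_quasi_periodic[OF \<tau> wp_holomorphic[OF \<tau>] that(1), of _ 0])
      (use that lattice_periodic[of \<tau> "wp_fn \<tau>"] wp_add_1[OF \<tau>] wp_add_tau[OF \<tau>] in auto)
  have odd: "deriv (wp_fn \<tau>) (- z) = - deriv (wp_fn \<tau>) z" if "z \<notin> lattice \<tau>" for z
  proof -
    have "- deriv (wp_fn \<tau>) (- z) = deriv (wp_fn \<tau>) z"
      using deriv_homogeneous[OF \<tau> wp_holomorphic[OF \<tau>] that, of "-1" 1] wp_minus[OF \<tau>] by simp
    then show ?thesis by (metis minus_minus)
  qed
  have even: "deriv (deriv (wp_fn \<tau>)) (- z) = deriv (deriv (wp_fn \<tau>)) z" if "z \<notin> lattice \<tau>" for z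
    using deriv_homogeneous[OF \<tau> hd that, of "-1" "-1"] odd by simp
  obtain C where C: "\<And>z. z \<notin> lattice \<tau> \<Longrightarrow> f z = C"
  proof (rule even_elliptic_constant[OF \<tau>, of f])
    show "f holomorphic_on - lattice \<tau>"
      unfolding f_def[abs_def] by (intro holomorphic_intros wp_holomorphic \<tau> o) auto
    show "((\<lambda>z. z ^ 2 * f z) \<longlongrightarrow> 0) (at 0)"
    proof (rule Lim_transform_eventually)
      let ?g = "\<lambda>z. (z ^ 2 * geo z + z ^ 2 * geo z ^ 2) * (1 - 12 * R z - k) +
          z ^ 2 * ((deriv ^^ 3) (zeta_reg \<tau>) z / c2pi ^ 3 - 6 * R z ^ 2 - k * R z)"
      have "(?g \<longlongrightarrow> (0 + 1 / c2pi ^ 2) * (1 - 12 * R 0 - k) +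
          0 ^ 2 * ((deriv ^^ 3) (zeta_reg \<tau>) 0 / c2pi ^ 3 - 6 * R 0 ^ 2 - k * R 0)) (at 0)"
        unfolding R_def by (intro tendsto_intros geo_square_tendsto_0 zeta_reg_deriv_tendsto \<tau>) auto
      then show "(?g \<longlongrightarrow> 0) (at 0)" by (simp add: k_def)
      show "\<forall>\<^sub>F z in at 0. ?g z = z ^ 2 * f z"
        using eventually_in_strip_diff_lattice[OF \<tau>]
      proof eventually_elim
        case (elim z)
        define g where "g = geo z + geo z ^ 2"
        have wp: "wp_fn \<tau> z = c2pi * (g + R z)"
          by (simp add: wp_eq[OF \<tau> elim] g_def R_def algebra_simps)
        have wp2: "(deriv ^^ 2) (wp_fn \<tau>) z = c2pi ^ 3 * ((1 + 6 * g) * g) + (deriv ^^ 3) (zeta_reg \<tau>) z"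
          by (simp only: wp_deriv2_eq[OF \<tau> elim] g_def) (simp add: algebra_simps)
        have f: "f z = (1 + 6 * g) * g + (deriv ^^ 3) (zeta_reg \<tau>) z / c2pi ^ 3 - 6 * (g + R z) ^ 2 - k * (g + R z)"
          unfolding f_def wp wp2 by (simp add: add_divide_distrib power_mult_distrib)
        show ?case
          unfolding f by (simp add: algebra_simps g_def power2_eq_square)
      qed
    qed
  qed (use dper[of 1] dper[of \<tau>] even wp_add_1[OF \<tau>] wp_add_tau[OF \<tau>] wp_minus[OF \<tau>] in
      \<open>auto simp: f_def numeral_2_eq_2\<close>)
  show ?thesis
  proof (rule that)
    fix z assume "z \<notin> lattice \<tau>"
    from C[OF this] have "c2pi ^ 3 * f z = c2pi ^ 3 * C" by simp
    moreover have "c2pi ^ 3 * f z =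
        (deriv ^^ 2) (wp_fn \<tau>) z - 6 * c2pi * wp_fn \<tau> z ^ 2 - c2pi ^ 2 * k * wp_fn \<tau> z"
      by (simp add: f_def right_diff_distrib power2_eq_square power3_eq_cube)
    ultimately show "(deriv ^^ 2) (wp_fn \<tau>) z =
        6 * c2pi * wp_fn \<tau> z ^ 2 + (c2pi ^ 2 * k) * wp_fn \<tau> z + c2pi ^ 3 * C"
      by (simp add: algebra_simps)
  qed
qed

text \<open>Both sides have the same double pole at 0, so their difference is constant.
  \<open>C\<close> absorbs the linear correction in \<open>zeta_fn\<close>, which is not homogeneous
  in the lattice.\<close>

theorem wp_rescale:
  assumes \<tau>: "Im \<tau> > 0" and \<tau>': "Im \<tau>' > 0" and a: "a \<noteq> 0"
    and iff: "\<And>z. a * z \<in> lattice \<tau>' \<longleftrightarrow> z \<in> lattice \<tau>"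
  obtains C where "\<And>z. z \<notin> lattice \<tau> \<Longrightarrow> wp_fn \<tau> z = a ^ 2 * wp_fn \<tau>' (a * z) + C"
proof -
  obtain C where C: "\<And>z. z \<notin> lattice \<tau> \<Longrightarrow> wp_fn \<tau> z - a ^ 2 * wp_fn \<tau>' (a * z) = C"
  proof (rule even_elliptic_constant[OF \<tau>, of "\<lambda>z. wp_fn \<tau> z - a ^ 2 * wp_fn \<tau>' (a * z)"])
    show "(\<lambda>z. wp_fn \<tau> z - a ^ 2 * wp_fn \<tau>' (a * z)) holomorphic_on - lattice \<tau>"
      by (intro holomorphic_intros wp_holomorphic holomorphic_on_compose_lattice[OF wp_holomorphic] \<tau> \<tau>')
        (use iff in auto)
    have per: "wp_fn \<tau>' (a * (z + w)) = wp_fn \<tau>' (a * z)" if "z \<notin> lattice \<tau>" "w \<in> lattice \<tau>" for z w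
      using lattice_periodic[of \<tau>' "wp_fn \<tau>'" "a * w" "a * z"] wp_add_1[OF \<tau>'] wp_add_tau[OF \<tau>'] that iff
      by (simp add: distrib_left)
    show "wp_fn \<tau> (z + 1) - a ^ 2 * wp_fn \<tau>' (a * (z + 1)) = wp_fn \<tau> z - a ^ 2 * wp_fn \<tau>' (a * z)"
      "wp_fn \<tau> (z + \<tau>) - a ^ 2 * wp_fn \<tau>' (a * (z + \<tau>)) = wp_fn \<tau> z - a ^ 2 * wp_fn \<tau>' (a * z)"
      "wp_fn \<tau> (- z) - a ^ 2 * wp_fn \<tau>' (a * (- z)) = wp_fn \<tau> z - a ^ 2 * wp_fn \<tau>' (a * z)"
      if "z \<notin> lattice \<tau>" for z
      using that per[OF that] wp_add_1[OF \<tau>] wp_add_tau[OF \<tau>] wp_minus[OF \<tau>] wp_minus[OF \<tau>', of "a * z"] iff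
      by simp_all
    have "filterlim (\<lambda>z. a * z) (at 0) (at 0)"
      using a by (intro filterlim_atI tendsto_mult_right_zero tendsto_ident_at)
        (auto simp: eventually_at_filter)
    from filterlim_compose[OF wp_tendsto_0[OF \<tau>'] this]
    have "((\<lambda>z. z ^ 2 * wp_fn \<tau> z - (a * z) ^ 2 * wp_fn \<tau>' (a * z)) \<longlongrightarrow> 1 / c2pi - 1 / c2pi) (at 0)"
      by (intro tendsto_diff wp_tendsto_0 \<tau>)
    then show "((\<lambda>z. z ^ 2 * (wp_fn \<tau> z - a ^ 2 * wp_fn \<tau>' (a * z))) \<longlongrightarrow> 0) (at 0)"
      by (simp add: algebra_simps power_mult_distrib)
  qed (use that in auto)
  then show ?thesis
    by (intro that[of C]) (auto simp: algebra_simps dest: C)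
qed

section \<open>Lambert series\<close>

lemma summable_power_mult_power:
  fixes x :: real
  assumes "0 \<le> x" "x < 1"
  shows "summable (\<lambda>n. real n ^ r * x ^ n)"
proof -
  have "(\<lambda>n. of_nat n ^ r * 1 * of_real x ^ n) sums (q_deriv ^^ r) (\<lambda>z. \<Sum>n. 1 * z ^ n) (complex_of_real x)"
    by (rule q_deriv_funpow_power_series) (use assms in auto)
  then have "summable (\<lambda>n. complex_of_real (real n ^ r * x ^ n))"
    by (simp add: sums_iff)
  then show ?thesis by (simp only: summable_complex_of_real)
qed

lemma norm_power_Suc_less_1:
  fixes x :: complex
  assumes "norm x < 1"
  shows "norm (x ^ Suc k) < 1"
proof -
  have "norm x ^ Suc k \<le> norm x ^ 1"
    using assms by (intro power_decreasing) auto
  with assms show ?thesis unfolding norm_power by simp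
qed

text \<open>Rearrangement of the double series over pairs (d, e) by their product, using (de)^r d^s
  = d^(r+s) e^r. The inner sum over e enters as \<open>g\<close> so that its closed form can be
  supplied for each r.\<close>

theorem Phi_tilde_lambert:
  assumes q: "norm q < 1"
    and g: "\<And>k. (\<lambda>n. of_nat (Suc n) ^ r * (q ^ Suc k) ^ Suc n) sums g k"
  shows "(\<lambda>k. (- 1) ^ k * of_nat (Suc k) ^ (r + s) * g k) sums Phi_tilde r (r + s) q"
proof -
  define f :: "nat \<times> nat \<Rightarrow> complex" where
    "f = (\<lambda>(k, n). (- 1) ^ k * of_nat (Suc k) ^ (r + s) * (of_nat (Suc n) ^ r * (q ^ Suc k) ^ Suc n))"
  \<comment> \<open>Unlike \<open>norm q\<close>, this majorant is positive also for q = 0, and the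
    bound below divides by it.\<close>
  define x where "x = (1 + norm q) / 2"
  have x: "0 < x" "norm q \<le> x" "x < 1"
    using q norm_ge_zero[of q] by (auto simp: x_def simp del: norm_ge_zero)
  define u where "u m n = real (Suc n) ^ m * x ^ Suc n" for m n :: nat
  have "summable (u m)" for m
    using summable_power_mult_power[of x m] x unfolding u_def
    by (subst summable_Suc_iff) (simp add: less_imp_le)
  then have u: "u m summable_on UNIV" for m
    using x by (intro summable_nonneg_imp_summable_on) (auto simp: u_def)
  have "(\<lambda>(k, n). u (r + s) k * u r n / x) summable_on Sigma UNIV (\<lambda>_. UNIV)"
  proof (rule summable_on_SigmaI)
    show "((\<lambda>n. case (k, n) of (k, n) \<Rightarrow> u (r + s) k * u r n / x) has_sum (u (r + s) k * infsum (u r) UNIV / x)) UNIV" for k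
    proof -
      have "((\<lambda>n. (u (r + s) k / x) * u r n) has_sum (u (r + s) k / x) * infsum (u r) UNIV) UNIV"
        using u by (intro has_sum_cmult_right) auto
      then show ?thesis by simp
    qed
    have "(\<lambda>k. u (r + s) k * (infsum (u r) UNIV / x)) summable_on UNIV"
      by (intro summable_on_cmult_left u)
    then show "(\<lambda>k. u (r + s) k * infsum (u r) UNIV / x) summable_on UNIV"
      by simp
  qed (use x in \<open>auto simp: u_def\<close>)
  moreover have "norm (f z) \<le> (case z of (k, n) \<Rightarrow> u (r + s) k * u r n / x)" for z
  proof (cases z)
    case (Pair k n)
    have "norm ((q ^ Suc k) ^ Suc n) = norm q ^ (Suc k * Suc n)"
      by (simp only: norm_power power_mult)
    also have "\<dots> \<le> x ^ (Suc k * Suc n)"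
      using x by (intro power_mono) auto
    \<comment> \<open>The exponent (k + 1)(n + 1) is at least (k + 1) + n, so the bound splits into
      a function of k times a function of n.\<close>
    also have "\<dots> \<le> x ^ (Suc k + n)"
      using x by (intro power_decreasing) auto
    also have "\<dots> = x ^ Suc k * x ^ Suc n / x"
      using x by (simp add: power_add)
    finally have "real (Suc k) ^ (r + s) * real (Suc n) ^ r * norm ((q ^ Suc k) ^ Suc n) \<le>
        real (Suc k) ^ (r + s) * real (Suc n) ^ r * (x ^ Suc k * x ^ Suc n / x)"
      by (intro mult_left_mono) auto
    moreover have "norm (f (k, n)) = real (Suc k) ^ (r + s) * real (Suc n) ^ r * norm ((q ^ Suc k) ^ Suc n)"
      unfolding f_def prod.case norm_mult norm_power norm_of_nat by simp
    ultimately show ?thesis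
      unfolding Pair prod.case u_def by (simp add: mult_ac del: power_Suc of_nat_Suc)
  qed
  ultimately have "(\<lambda>z. norm (f z)) summable_on Sigma UNIV (\<lambda>_. UNIV)"
    by (rule Infinite_Sum.abs_summable_on_comparison_test')
  then have "f summable_on Sigma UNIV (\<lambda>_. UNIV)"
    by (rule abs_summable_summable)
  then obtain S where S: "(f has_sum S) (Sigma UNIV (\<lambda>_. UNIV))"
    by (auto simp: summable_on_def)
  have "((\<lambda>k. (- 1) ^ k * of_nat (Suc k) ^ (r + s) * g k) has_sum S) UNIV"
  proof (rule has_sum_SigmaD[OF S])
    fix k
    have "norm q ^ Suc k < 1"
      using norm_power_Suc_less_1[OF q] by (simp only: norm_power)
    have "summable (\<lambda>n. real n ^ r * (norm q ^ Suc k) ^ n)"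
      using \<open>norm q ^ Suc k < 1\<close> by (intro summable_power_mult_power) auto
    then have "summable (\<lambda>n. real (Suc n) ^ r * (norm q ^ Suc k) ^ Suc n)"
      by (subst summable_Suc_iff)
    then have "summable (\<lambda>n. norm (of_nat (Suc n) ^ r * (q ^ Suc k) ^ Suc n))"
      by (simp only: norm_mult norm_power norm_of_nat)
    then have "((\<lambda>n. of_nat (Suc n) ^ r * (q ^ Suc k) ^ Suc n) has_sum g k) UNIV"
      by (rule norm_summable_imp_has_sum) (rule g)
    then show "((\<lambda>n. f (k, n)) has_sum (- 1) ^ k * of_nat (Suc k) ^ (r + s) * g k) UNIV"
      unfolding f_def prod.case by (rule has_sum_cmult_right)
  qed
  then have 1: "(\<lambda>k. (- 1) ^ k * of_nat (Suc k) ^ (r + s) * g k) sums S"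
    by (rule has_sum_imp_sums)
  define h :: "nat \<times> nat \<Rightarrow> complex" where
    "h = (\<lambda>(m, d). of_nat (Suc m) ^ r * ((- 1) ^ (d - 1) * of_nat d ^ s) * q ^ Suc m)"
  have "(h has_sum S) (Sigma UNIV (\<lambda>m. {d. d dvd Suc m})) \<longleftrightarrow> (f has_sum S) (Sigma UNIV (\<lambda>_. UNIV))"
  proof (rule has_sum_reindex_bij_witness[where i = "\<lambda>(k, n). (Suc k * Suc n - 1, Suc k)"
        and j = "\<lambda>(m, d). (d - 1, Suc m div d - 1)"])
    let ?i = "\<lambda>(k, n). (Suc k * Suc n - 1, Suc k)" and ?j = "\<lambda>(m, d). (d - 1, Suc m div d - 1)"
    fix a assume "a \<in> Sigma UNIV (\<lambda>m. {d. d dvd Suc m})"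
    then obtain m d where a: "a = (m, d)" "d dvd Suc m" by auto
    then obtain e where e: "Suc m = d * e" by (auto simp: dvd_def)
    then have "d \<noteq> 0" "e \<noteq> 0" by (metis mult_is_0 nat.distinct(2))+
    then obtain k n where kn: "d = Suc k" "e = Suc n" by (metis not0_implies_Suc)
    have m: "m = Suc k * Suc n - 1" using e kn by (metis diff_Suc_1)
    have ja: "?j a = (k, n)"
    proof -
      have "Suc m div d = e" using e \<open>d \<noteq> 0\<close> by simp
      with kn show ?thesis by (simp add: a)
    qed
    show "?i (?j a) = a"
      unfolding ja unfolding prod.case a m kn ..
    show "f (?j a) = h a"
      unfolding ja unfolding f_def h_def prod.case a e unfolding kn
      by (simp only: of_nat_mult power_mult_distrib power_add power_mult diff_Suc_1 mult_ac)
  next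
    fix b :: "nat \<times> nat"
    obtain k n where b: "b = (k, n)" by (cases b)
    have *: "Suc (Suc k * Suc n - 1) = Suc k * Suc n" by simp
    show "(case case b of (k, n) \<Rightarrow> (Suc k * Suc n - 1, Suc k) of (m, d) \<Rightarrow> (d - 1, Suc m div d - 1)) = b"
      unfolding b prod.case * by (simp del: mult_Suc mult_Suc_right)
    show "(case b of (k, n) \<Rightarrow> (Suc k * Suc n - 1, Suc k)) \<in> Sigma UNIV (\<lambda>m. {d. d dvd Suc m})"
      unfolding b prod.case mem_Sigma_iff mem_Collect_eq * by (intro conjI UNIV_I dvd_triv_left)
  qed auto
  with S have hS: "(h has_sum S) (Sigma UNIV (\<lambda>m. {d. d dvd Suc m}))" by blast
  have "((\<lambda>m. of_nat (Suc m) ^ r * of_int (sigma_tilde s (Suc m)) * q ^ Suc m) has_sum S) UNIV"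
  proof (rule has_sum_SigmaD[OF hS])
    show "((\<lambda>d. h (m, d)) has_sum of_nat (Suc m) ^ r * of_int (sigma_tilde s (Suc m)) * q ^ Suc m) {d. d dvd Suc m}" for m
      by (rule has_sum_finiteI)
        (simp_all add: h_def sigma_tilde_def sum_distrib_left sum_distrib_right del: of_nat_Suc power_Suc)
  qed
  then have "(\<lambda>m. of_nat (Suc m) ^ r * of_int (sigma_tilde s (Suc m)) * q ^ Suc m) sums S"
    by (rule has_sum_imp_sums)
  with Phi_tilde_sums[OF q, of r "r + s"] have "S = Phi_tilde r (r + s) q"
    using sums_unique2 by fastforce
  with 1 show ?thesis by simp
qed

text \<open>The alternating sign is absorbed into (-q)^k, the form in which the nome series at
  \<tau> + 1/2 and \<tau> - 1/2 deliver it. The added term k = 0 vanishes because the exponent is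
  \<open>Suc s\<close>.\<close>

lemma Phi_tilde_lambert_0:
  assumes q: "norm q < 1"
  shows "(\<lambda>k. of_nat k ^ Suc s * (- q) ^ k / (1 - q ^ k)) sums (- Phi_tilde 0 (Suc s) q)"
proof -
  have "(\<lambda>k. (- 1) ^ k * of_nat (Suc k) ^ (0 + Suc s) * (q ^ Suc k / (1 - q ^ Suc k))) sums Phi_tilde 0 (0 + Suc s) q"
  proof (rule Phi_tilde_lambert[OF q])
    fix k
    have "norm (q ^ Suc k) < 1"
      by (rule norm_power_Suc_less_1[OF q])
    from sums_mult[OF geometric_sums[OF this], of "q ^ Suc k"]
    show "(\<lambda>n. of_nat (Suc n) ^ 0 * (q ^ Suc k) ^ Suc n) sums (q ^ Suc k / (1 - q ^ Suc k))"
      by simp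
  qed
  then have "(\<lambda>k. - ((- 1) ^ k * of_nat (Suc k) ^ (0 + Suc s) * (q ^ Suc k / (1 - q ^ Suc k)))) sums (- Phi_tilde 0 (0 + Suc s) q)"
    by (rule sums_minus)
  moreover have "- ((- 1) ^ k * of_nat (Suc k) ^ (0 + Suc s) * (q ^ Suc k / (1 - q ^ Suc k))) =
      of_nat (Suc k) ^ Suc s * (- q) ^ Suc k / (1 - q ^ Suc k)" for k
    by (simp add: mult_ac power_minus[of q k])
  ultimately show ?thesis
    using sums_Suc_iff[of "\<lambda>k. of_nat k ^ Suc s * (- q) ^ k / (1 - q ^ k)"] by (simp del: power_Suc of_nat_Suc)
qed

lemma Phi_tilde_lambert_1:
  assumes q: "norm q < 1"
  shows "(\<lambda>k. of_nat k ^ Suc s * (- q) ^ k / (1 - q ^ k) ^ 2) sums (- Phi_tilde 1 (Suc s) q)"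
proof -
  have "(\<lambda>k. (- 1) ^ k * of_nat (Suc k) ^ (1 + s) * (q ^ Suc k / (1 - q ^ Suc k) ^ 2)) sums Phi_tilde 1 (1 + s) q"
  proof (rule Phi_tilde_lambert[OF q])
    fix k
    have "norm (q ^ Suc k) < 1"
      by (rule norm_power_Suc_less_1[OF q])
    from sums_mult[OF geometric_deriv_sums[OF this], of "q ^ Suc k"]
    show "(\<lambda>n. of_nat (Suc n) ^ 1 * (q ^ Suc k) ^ Suc n) sums (q ^ Suc k / (1 - q ^ Suc k) ^ 2)"
      by (simp add: mult_ac)
  qed
  then have "(\<lambda>k. - ((- 1) ^ k * of_nat (Suc k) ^ (1 + s) * (q ^ Suc k / (1 - q ^ Suc k) ^ 2))) sums (- Phi_tilde 1 (1 + s) q)"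
    by (rule sums_minus)
  moreover have "- ((- 1) ^ k * of_nat (Suc k) ^ (1 + s) * (q ^ Suc k / (1 - q ^ Suc k) ^ 2)) =
      of_nat (Suc k) ^ Suc s * (- q) ^ Suc k / (1 - q ^ Suc k) ^ 2" for k
    by (simp add: mult_ac power_minus[of q k])
  ultimately show ?thesis
    using sums_Suc_iff[of "\<lambda>k. of_nat k ^ Suc s * (- q) ^ k / (1 - q ^ k) ^ 2"] by (simp del: power_Suc of_nat_Suc)
qed

section \<open>Values at a half period\<close>

lemma half_notin_lattice: "Im \<tau> > 0 \<Longrightarrow> 1 / 2 \<notin> lattice \<tau>"
proof
  assume \<tau>: "Im \<tau> > 0" and "1 / 2 \<in> lattice \<tau>"
  then obtain m n where *: "1 / 2 = of_int m + of_int n * \<tau>"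
    unfolding lattice_def by blast
  have "Im (1 / 2) = real_of_int n * Im \<tau>" "Re (1 / 2) = real_of_int m + real_of_int n * Re \<tau>"
    unfolding * by simp_all
  with \<tau> have "1 / 2 = real_of_int m" by simp
  then have "real_of_int (2 * m) = real_of_int 1" by simp
  then show False by (simp only: of_int_eq_iff) presburger
qed

lemma geo_half: "geo (1 / 2) = - 1 / 2"
  by (simp add: geo_def)

text \<open>These become the constants that accompany the Lambert series in the Taylor coefficients
  of \<open>zeta_fn\<close> at 1/2.\<close>

lemma
  shows deriv_geo_half: "deriv geo (1 / 2) = - c2pi / 4"
    and deriv3_geo_half: "(deriv ^^ 3) geo (1 / 2) = c2pi ^ 3 / 8"
    and deriv5_geo_half: "(deriv ^^ 5) geo (1 / 2) = - (c2pi ^ 5) / 4"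
proof -
  \<comment> \<open>Any lattice would do: its complement is an open set around 1/2 on which the nome
    differs from 1.\<close>
  define S where "S = - lattice \<i>"
  have S: "open S" unfolding S_def by (intro open_compl_lattice) simp
  have h: "1 / 2 \<in> S" unfolding S_def using half_notin_lattice[of \<i>] by simp
  have geo: "(geo has_field_derivative c2pi * (geo w + geo w ^ 2)) (at w)" if "w \<in> S" for w
    using that unfolding S_def by (intro geo_field_derivative nome_neq_1) auto
  have 1: "deriv geo w = c2pi * (geo w + geo w ^ 2)" if "w \<in> S" for w
    by (rule DERIV_imp_deriv[OF geo[OF that]])
  \<comment> \<open>Iterating the Riccati equation, the coefficient of geo^j in the n-th derivative
    is c2pi^n (j-1)! S(n+1, j), with S the Stirling numbers of the second kind.\<close>
  have 2: "deriv (deriv geo) w = c2pi ^ 2 * (geo w + 3 * geo w ^ 2 + 2 * geo w ^ 3)" if w: "w \<in> S" for w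
    by (rule DERIV_imp_deriv[OF has_field_derivative_cong_open[OF S w 1]], assumption)
      (rule derivative_eq_intros geo[OF w] refl | simp add: algebra_simps power2_eq_square power3_eq_cube)+
  have 3: "deriv (deriv (deriv geo)) w = c2pi ^ 3 * (geo w + 7 * geo w ^ 2 + 12 * geo w ^ 3 + 6 * geo w ^ 4)"
    if w: "w \<in> S" for w
    by (rule DERIV_imp_deriv[OF has_field_derivative_cong_open[OF S w 2]], assumption)
      (rule derivative_eq_intros geo[OF w] refl | simp add: algebra_simps power_numeral_reduce)+
  have 4: "deriv (deriv (deriv (deriv geo))) w =
      c2pi ^ 4 * (geo w + 15 * geo w ^ 2 + 50 * geo w ^ 3 + 60 * geo w ^ 4 + 24 * geo w ^ 5)"
    if w: "w \<in> S" for w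
    by (rule DERIV_imp_deriv[OF has_field_derivative_cong_open[OF S w 3]], assumption)
      (rule derivative_eq_intros geo[OF w] refl | simp add: algebra_simps power_numeral_reduce)+
  have 5: "deriv (deriv (deriv (deriv (deriv geo)))) w =
      c2pi ^ 5 * (geo w + 31 * geo w ^ 2 + 180 * geo w ^ 3 + 390 * geo w ^ 4 + 360 * geo w ^ 5 + 120 * geo w ^ 6)"
    if w: "w \<in> S" for w
    by (rule DERIV_imp_deriv[OF has_field_derivative_cong_open[OF S w 4]], assumption)
      (rule derivative_eq_intros geo[OF w] refl | simp add: algebra_simps power_numeral_reduce)+
  show "deriv geo (1 / 2) = - c2pi / 4"
    by (simp add: 1[OF h] geo_half power_numeral_reduce)
  show "(deriv ^^ 3) geo (1 / 2) = c2pi ^ 3 / 8"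
    using 3[OF h] by (simp add: eval_nat_numeral geo_half)
  show "(deriv ^^ 5) geo (1 / 2) = - (c2pi ^ 5) / 4"
    using 5[OF h] by (simp add: eval_nat_numeral geo_half)
qed

context
  fixes \<tau> :: complex
  assumes \<tau>: "Im \<tau> > 0"
begin

text \<open>Shifting \<tau> by a half in either direction negates the nome, and this creates the
  alternating sign.\<close>

lemma higher_deriv_at_half_tau:
  assumes f: "nome_series a f" and w: "w = 1 / 2 \<or> w = - 1 / 2"
  shows "(\<lambda>k. (c2pi * of_nat k) ^ j * a k * (- nome \<tau>) ^ k) sums (deriv ^^ j) f (\<tau> + w)"
proof -
  have "nome (- 1 / 2) = - 1"
    using nome_minus[of "1 / 2"] by simp
  then have "nome w = - 1" using w by (metis nome_half)
  then have "nome (\<tau> + w) = - nome \<tau>"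
    by (simp add: nome_add)
  moreover have "Im w = 0" using w by (elim disjE) (simp_all only:, simp_all)
  then have "Im (\<tau> + w) > 0" using \<tau> by simp
  ultimately show ?thesis
    using nome_series_sums[OF nome_series_higher_deriv[OF f], of "\<tau> + w" j] by simp
qed

text \<open>For odd \<open>j\<close> the reflection z to \<tau> - z contributes a second minus sign,
  so the two Lambert terms of \<open>zeta_fn\<close> add up instead of cancelling.\<close>

lemma zeta_odd_deriv_half:
  assumes "odd j"
  shows "(deriv ^^ j) (zeta_fn \<tau>) (1 / 2) = (deriv ^^ j) geo (1 / 2) - 2 * c2pi ^ j * Phi_tilde 0 j (nome \<tau>)"
proof -
  let ?S = "strip \<tau> - lattice \<tau>"
  have S: "open ?S"
    by (intro open_Diff open_strip closed_lattice \<tau>)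
  have h: "1 / 2 \<in> ?S"
    using half_notin_lattice[OF \<tau>] \<tau> by (simp add: strip_def)
  have geo: "geo holomorphic_on ?S"
    by (rule holomorphic_on_subset[OF geo_holomorphic]) auto
  note hol = holomorphic_on_subset[OF holomorphic_on_strip(2)[OF lambert_fn_nome_series[OF \<tau>]], of ?S]
    holomorphic_on_subset[OF holomorphic_on_strip(3)[OF lambert_fn_nome_series[OF \<tau>]], of ?S]
  have z: "zeta_fn \<tau> holomorphic_on ?S"
    by (rule holomorphic_on_subset[OF zeta_holomorphic[OF \<tau>]]) auto
  have lambert_fn: "(deriv ^^ j) (lambert_fn \<tau>) (\<tau> + w) = - (c2pi ^ j) * Phi_tilde 0 j (nome \<tau>)" if "w = 1 / 2 \<or> w = - 1 / 2" for w
  proof -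
    obtain s where s: "j = Suc s" using assms odd_pos[of j] by (cases j) auto
    have "norm (nome \<tau>) < 1" using \<tau> by simp
    from sums_mult[OF Phi_tilde_lambert_0[OF this, of s], of "c2pi ^ j"]
    have 1: "(\<lambda>k. c2pi ^ j * (of_nat k ^ Suc s * (- nome \<tau>) ^ k / (1 - nome \<tau> ^ k))) sums (- (c2pi ^ j) * Phi_tilde 0 j (nome \<tau>))"
      by (simp add: s del: power_Suc)
    have 2: "(c2pi * of_nat k) ^ j * ((if k = 0 then 0 else 1) / (1 - nome \<tau> ^ k)) * (- nome \<tau>) ^ k =
        c2pi ^ j * (of_nat k ^ Suc s * (- nome \<tau>) ^ k / (1 - nome \<tau> ^ k))" for k
      by (simp add: s power_mult_distrib del: power_Suc)
    show ?thesis
      by (rule sums_unique2[OF higher_deriv_at_half_tau[OF lambert_fn_nome_series[OF \<tau>] that, of j, unfolded 2] 1])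
  qed
  have "(deriv ^^ j) (zeta_fn \<tau>) (1 / 2) =
      (deriv ^^ j) (\<lambda>z. (geo z + 1 / 2) + (lambert_fn \<tau> (z + \<tau>) - lambert_fn \<tau> (\<tau> - z))) (1 / 2)"
    by (rule higher_deriv_transform_within_open[OF z _ S h])
      (use zeta_eq[OF \<tau>] geo hol in \<open>auto intro!: holomorphic_intros simp: zeta_reg_def\<close>)
  also have "\<dots> = (deriv ^^ j) (\<lambda>z. geo z + 1 / 2) (1 / 2) +
      (deriv ^^ j) (\<lambda>z. lambert_fn \<tau> (z + \<tau>) - lambert_fn \<tau> (\<tau> - z)) (1 / 2)"
    by (rule higher_deriv_add[OF _ _ S h]) (use geo hol in \<open>auto intro!: holomorphic_intros\<close>)
  also have "(deriv ^^ j) (\<lambda>z. geo z + 1 / 2) (1 / 2) = (deriv ^^ j) geo (1 / 2) + (deriv ^^ j) (\<lambda>z. 1 / 2) (1 / 2)"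
    by (rule higher_deriv_add[OF _ _ S h]) (use geo hol in \<open>auto intro!: holomorphic_intros\<close>)
  also have "(deriv ^^ j) (\<lambda>z. 1 / 2) (1 / 2 :: complex) = (0 :: complex)"
    using assms odd_pos[of j] by simp
  also have "(deriv ^^ j) (\<lambda>z. lambert_fn \<tau> (z + \<tau>) - lambert_fn \<tau> (\<tau> - z)) (1 / 2) =
      (deriv ^^ j) (\<lambda>z. lambert_fn \<tau> (z + \<tau>)) (1 / 2) - (deriv ^^ j) (\<lambda>z. lambert_fn \<tau> (\<tau> - z)) (1 / 2)"
    by (rule higher_deriv_diff[OF _ _ S h]) (use hol in auto)
  also have "(deriv ^^ j) (\<lambda>z. lambert_fn \<tau> (z + \<tau>)) (1 / 2) = (deriv ^^ j) (lambert_fn \<tau>) (\<tau> + 1 / 2)"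
    using higher_deriv_compose_linear'[OF nome_series_holomorphic[OF lambert_fn_nome_series[OF \<tau>]] open_strip
        open_halfspace_Im_gt, of "1 / 2" \<tau> 1 \<tau> j] \<tau>
    by (auto simp: strip_def add.commute)
  also have "(deriv ^^ j) (\<lambda>z. lambert_fn \<tau> (\<tau> - z)) (1 / 2) = - (deriv ^^ j) (lambert_fn \<tau>) (\<tau> + - 1 / 2)"
    using higher_deriv_compose_linear'[OF nome_series_holomorphic[OF lambert_fn_nome_series[OF \<tau>]] open_strip
        open_halfspace_Im_gt, of "1 / 2" \<tau> "-1" \<tau> j] \<tau> assms
    by (auto simp: strip_def)
  finally show ?thesis
    using lambert_fn[of "1 / 2"] lambert_fn[of "- 1 / 2"] by simp
qed

text \<open>Oddness together with the period 1 makes \<open>zeta_fn\<close> odd about the point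
  1/2.\<close>

lemma zeta_even_deriv_half:
  assumes "even j"
  shows "(deriv ^^ j) (zeta_fn \<tau>) (1 / 2) = 0"
proof -
  have o: "open (- lattice \<tau>)" by (rule open_compl_lattice[OF \<tau>])
  have h: "1 / 2 \<in> - lattice \<tau>" using half_notin_lattice[OF \<tau>] by simp
  have lat: "- 1 * w + 1 \<in> - lattice \<tau>" if "w \<in> - lattice \<tau>" for w
    using that by simp
  have eq: "zeta_fn \<tau> (- 1 * w + 1) = - zeta_fn \<tau> w" if "w \<in> - lattice \<tau>" for w
    using that zeta_add_1[of \<tau> "- w"] zeta_minus[OF \<tau>] by simp
  have "(deriv ^^ j) (zeta_fn \<tau>) (1 / 2) = (- 1) ^ j * (deriv ^^ j) (zeta_fn \<tau>) (- 1 * (1 / 2) + 1)"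
    using assms by simp
  also have "\<dots> = (deriv ^^ j) (\<lambda>w. zeta_fn \<tau> (- 1 * w + 1)) (1 / 2)"
    by (rule higher_deriv_compose_linear'[OF zeta_holomorphic[OF \<tau>] o o h lat, symmetric])
  also have "\<dots> = (deriv ^^ j) (\<lambda>w. - zeta_fn \<tau> w) (1 / 2)"
    by (rule higher_deriv_transform_within_open[OF _ _ o h eq])
      (use lat in \<open>auto intro!: holomorphic_intros zeta_holomorphic[OF \<tau>] holomorphic_on_compose_lattice[OF zeta_holomorphic[OF \<tau>]]\<close>)
  also have "\<dots> = - (deriv ^^ j) (zeta_fn \<tau>) (1 / 2)"
    by (rule higher_deriv_uminus[OF zeta_holomorphic[OF \<tau>] o h])
  finally show ?thesis by simp
qed

lemma zeta_deriv_half: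
  "deriv (zeta_fn \<tau>) (1 / 2) = - c2pi * (1 / 4 + 2 * Phi_tilde 0 1 (nome \<tau>))"
  "(deriv ^^ 3) (zeta_fn \<tau>) (1 / 2) = c2pi ^ 3 * (1 / 8 - 2 * Phi_tilde 0 3 (nome \<tau>))"
  "(deriv ^^ 5) (zeta_fn \<tau>) (1 / 2) = - (c2pi ^ 5) * (1 / 4 + 2 * Phi_tilde 0 5 (nome \<tau>))"
  using zeta_odd_deriv_half[of 1] zeta_odd_deriv_half[of 3] zeta_odd_deriv_half[of 5]
  by (simp_all add: deriv_geo_half deriv3_geo_half deriv5_geo_half algebra_simps)

lemma lambert_sq_deriv6_half: "(deriv ^^ 6) (lambert_sq_fn \<tau>) (1 / 2) = - 2 * c2pi ^ 6 * Phi_tilde 1 6 (nome \<tau>)"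
proof -
  have "norm (nome \<tau>) < 1" using \<tau> by simp
  from sums_mult[OF Phi_tilde_lambert_1[OF this, of 5], of "c2pi ^ 6"]
  have 1: "(\<lambda>k. c2pi ^ 6 * (of_nat k ^ 6 * (- nome \<tau>) ^ k / (1 - nome \<tau> ^ k) ^ 2)) sums (- (c2pi ^ 6) * Phi_tilde 1 6 (nome \<tau>))"
    by simp
  have 2: "(c2pi * of_nat k) ^ 6 * ((if k = 0 then 0 else 1) / (1 - nome \<tau> ^ k) / (1 - nome \<tau> ^ k)) * (- nome \<tau>) ^ k =
      c2pi ^ 6 * (of_nat k ^ 6 * (- nome \<tau>) ^ k / (1 - nome \<tau> ^ k) ^ 2)" for k
    by (simp add: power_mult_distrib power2_eq_square)
  have lambert_fn2: "(deriv ^^ 6) (lambert_fn2 \<tau>) (\<tau> + w) = - (c2pi ^ 6) * Phi_tilde 1 6 (nome \<tau>)" if "w = 1 / 2 \<or> w = - 1 / 2" for w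
    by (rule sums_unique2[OF higher_deriv_at_half_tau[OF lambert_fn2_nome_series[OF \<tau>] that, of 6, unfolded 2] 1])
  have h: "1 / 2 \<in> strip \<tau>" using \<tau> by (simp add: strip_def)
  have "(deriv ^^ 6) (lambert_sq_fn \<tau>) (1 / 2) =
      (deriv ^^ 6) (\<lambda>z. lambert_fn2 \<tau> (\<tau> + z)) (1 / 2) + (deriv ^^ 6) (\<lambda>z. lambert_fn2 \<tau> (\<tau> - z)) (1 / 2)"
    unfolding lambert_sq_fn_def[abs_def]
    by (intro higher_deriv_add[OF _ _ open_strip h] holomorphic_on_strip[OF lambert_fn2_nome_series[OF \<tau>]])
  also have "(deriv ^^ 6) (\<lambda>z. lambert_fn2 \<tau> (\<tau> + z)) (1 / 2) = (deriv ^^ 6) (lambert_fn2 \<tau>) (\<tau> + 1 / 2)"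
    using higher_deriv_compose_linear'[OF nome_series_holomorphic[OF lambert_fn2_nome_series[OF \<tau>]] open_strip
        open_halfspace_Im_gt, of "1 / 2" \<tau> 1 \<tau> 6] \<tau>
    by (auto simp: strip_def add.commute)
  also have "(deriv ^^ 6) (\<lambda>z. lambert_fn2 \<tau> (\<tau> - z)) (1 / 2) = (deriv ^^ 6) (lambert_fn2 \<tau>) (\<tau> + - 1 / 2)"
    using higher_deriv_compose_linear'[OF nome_series_holomorphic[OF lambert_fn2_nome_series[OF \<tau>]] open_strip
        open_halfspace_Im_gt, of "1 / 2" \<tau> "-1" \<tau> 6] \<tau>
    by (auto simp: strip_def)
  finally show ?thesis
    using lambert_fn2[of "1 / 2"] lambert_fn2[of "- 1 / 2"] by simp
qed

end

section \<open>Complex multiplication\<close>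

definition tau_half :: "real \<Rightarrow> complex" where
  "tau_half t = (1 + \<i> * of_real t) / 2"

lemma Im_tau_half [simp]: "Im (tau_half t) = t / 2"
  by (simp add: tau_half_def)

lemma nome_tau_half: "nome (tau_half t) = - exp (- of_real (pi * t))"
proof -
  have "c2pi * tau_half t = \<i> * of_real pi + - of_real (pi * t)"
    by (simp add: c2pi_def tau_half_def field_simps)
  then show ?thesis
    by (simp only: nome_def exp_add exp_pi_i') simp
qed

text \<open>With \<tau>' = \<open>tau_half (1 / t)\<close>, the generators 1 and
  \<open>tau_half t\<close> go to 2\<tau>' - 1 and \<tau>' - 1, a unimodular change of
  basis.\<close>

lemma lattice_tau_half_aux:
  assumes "t > 0" "z \<in> lattice (tau_half t)"
  shows "\<i> / of_real t * z \<in> lattice (tau_half (1 / t))"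
proof -
  obtain m n where "z = of_int m + of_int n * tau_half t"
    using assms(2) unfolding lattice_def by blast
  then have "\<i> / of_real t * z = of_int (- m - n) + of_int (2 * m + n) * tau_half (1 / t)"
    using assms(1) by (simp add: tau_half_def field_simps)
  then show ?thesis by (simp only: latticeI)
qed

lemma lattice_tau_half_iff:
  assumes t: "t > 0"
  shows "\<i> / of_real t * z \<in> lattice (tau_half (1 / t)) \<longleftrightarrow> z \<in> lattice (tau_half t)"
proof
  assume "\<i> / of_real t * z \<in> lattice (tau_half (1 / t))"
  from lattice_tau_half_aux[OF _ this] t
  have "\<i> / of_real (1 / t) * (\<i> / of_real t * z) \<in> lattice (tau_half t)"
    by simp
  also have "\<i> / of_real (1 / t) * (\<i> / of_real t * z) = - z"
    using t by simp
  finally show "z \<in> lattice (tau_half t)" by simp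
qed (rule lattice_tau_half_aux[OF t])

lemma higher_deriv_periodic:
  assumes \<tau>: "Im \<tau> > 0" and f: "f holomorphic_on - lattice \<tau>" and w: "w \<in> lattice \<tau>"
    and per: "\<And>z. z \<notin> lattice \<tau> \<Longrightarrow> f (z + w) = f z"
  shows "z \<notin> lattice \<tau> \<Longrightarrow> (deriv ^^ n) f (z + w) = (deriv ^^ n) f z"
proof (induction n arbitrary: z)
  case (Suc n)
  have "deriv ((deriv ^^ n) f) (z + w) = deriv ((deriv ^^ n) f) z"
    by (rule deriv_quasi_periodic[OF \<tau> _ w Suc.prems, of _ 0])
      (use Suc.IH holomorphic_higher_deriv[OF f open_compl_lattice[OF \<tau>]] in auto)
  then show ?case by simp
qed (use per in simp)

lemma wp_periodic:
  assumes "Im \<tau> > 0" "w \<in> lattice \<tau>" "z \<notin> lattice \<tau>"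
  shows "wp_fn \<tau> (z + w) = wp_fn \<tau> z"
  using lattice_periodic[of \<tau> "wp_fn \<tau>" w z] wp_add_1[of \<tau>] wp_add_tau[of \<tau>] assms by blast

lemma wp_higher_deriv: "(deriv ^^ n) (wp_fn \<tau>) = (deriv ^^ Suc n) (zeta_fn \<tau>)"
  by (simp only: wp_fn_def funpow_Suc_right o_apply)

text \<open>The similarity preserves the class of the half period 1/2, so the same Taylor
  coefficients appear on both sides of the transformation.\<close>

lemma half_shift_tau_half:
  "\<i> / of_real t * (1 / 2) = 1 / 2 + (tau_half (1 / t) - 1)"
  by (simp add: tau_half_def field_simps)

text \<open>
  The lattices of \<open>tau_half t\<close> and \<open>tau_half (1 / t)\<close> are similar, with ratio \<open>\<i> / t\<close>; since
  \<open>\<i>\<^sup>6 = - 1\<close>, this forces a zero at \<open>t = 1\<close> and ties the first two derivatives there to each other.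
\<close>

theorem Phi_tilde_0_5_transform:
  assumes t: "t > 0"
  shows "of_real t ^ 6 * (1 / 4 + 2 * Phi_tilde 0 5 (nome (tau_half t))) +
    (1 / 4 + 2 * Phi_tilde 0 5 (nome (tau_half (1 / t)))) = 0"
proof -
  define \<tau> where "\<tau> = tau_half t"
  define \<tau>' where "\<tau>' = tau_half (1 / t)"
  define a where "a = \<i> / of_real t"
  have \<tau>: "Im \<tau> > 0" and \<tau>': "Im \<tau>' > 0" using t by (simp_all add: \<tau>_def \<tau>'_def)
  have a: "a \<noteq> 0" using t by (simp add: a_def)
  have iff: "a * z \<in> lattice \<tau>' \<longleftrightarrow> z \<in> lattice \<tau>" for z
    unfolding a_def \<tau>_def \<tau>'_def by (rule lattice_tau_half_iff[OF t])
  obtain C where C: "\<And>z. z \<notin> lattice \<tau> \<Longrightarrow> wp_fn \<tau> z = a ^ 2 * wp_fn \<tau>' (a * z) + C"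
    using wp_rescale[OF \<tau> \<tau>' a iff] by blast
  note o = open_compl_lattice[OF \<tau>] open_compl_lattice[OF \<tau>']
  have h: "1 / 2 \<in> - lattice \<tau>" using half_notin_lattice[OF \<tau>] by simp
  have hol: "(\<lambda>z. wp_fn \<tau>' (a * z)) holomorphic_on - lattice \<tau>"
    by (intro holomorphic_on_compose_lattice[OF wp_holomorphic[OF \<tau>']] holomorphic_intros) (use iff in auto)
  \<comment> \<open>Four derivatives remove the unknown constant and contribute a^4; with the a^2 in
    front this gives weight 6.\<close>
  have "(deriv ^^ 4) (wp_fn \<tau>) (1 / 2) = (deriv ^^ 4) (\<lambda>z. a ^ 2 * wp_fn \<tau>' (a * z) + C) (1 / 2)"
    by (rule higher_deriv_transform_within_open[OF wp_holomorphic[OF \<tau>] _ o(1) h])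
      (use C hol in \<open>auto intro!: holomorphic_intros\<close>)
  also have "\<dots> = (deriv ^^ 4) (\<lambda>z. a ^ 2 * wp_fn \<tau>' (a * z)) (1 / 2) + (deriv ^^ 4) (\<lambda>z. C) (1 / 2)"
    by (rule higher_deriv_add[OF _ _ o(1) h]) (use hol in \<open>auto intro!: holomorphic_intros\<close>)
  also have "(deriv ^^ 4) (\<lambda>z. a ^ 2 * wp_fn \<tau>' (a * z)) (1 / 2) = a ^ 2 * (deriv ^^ 4) (\<lambda>z. wp_fn \<tau>' (a * z)) (1 / 2)"
    by (rule higher_deriv_cmult[OF hol h o(1)])
  also have "(deriv ^^ 4) (\<lambda>z. wp_fn \<tau>' (a * z)) (1 / 2) = a ^ 4 * (deriv ^^ 4) (wp_fn \<tau>') (a * (1 / 2))"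
    by (rule higher_deriv_compose_linear[OF wp_holomorphic[OF \<tau>'] o h]) (use iff in auto)
  also have "a * (1 / 2) = 1 / 2 + (\<tau>' - 1)"
    unfolding a_def \<tau>'_def by (rule half_shift_tau_half)
  also have "(deriv ^^ 4) (wp_fn \<tau>') (1 / 2 + (\<tau>' - 1)) = (deriv ^^ 4) (wp_fn \<tau>') (1 / 2)"
    using half_notin_lattice[OF \<tau>'] wp_periodic[OF \<tau>']
    by (intro higher_deriv_periodic[OF \<tau>' wp_holomorphic[OF \<tau>']] lattice_diff) auto
  finally have "(deriv ^^ 5) (zeta_fn \<tau>) (1 / 2) = a ^ 6 * (deriv ^^ 5) (zeta_fn \<tau>') (1 / 2)"
    unfolding wp_higher_deriv by (simp add: eval_nat_numeral mult.assoc)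
  then have *: "- (c2pi ^ 5) * (1 / 4 + 2 * Phi_tilde 0 5 (nome \<tau>)) =
      a ^ 6 * (- (c2pi ^ 5) * (1 / 4 + 2 * Phi_tilde 0 5 (nome \<tau>')))" (is "- (c2pi ^ 5) * ?h = _ * (_ * ?h')")
    unfolding zeta_deriv_half(3)[OF \<tau>] zeta_deriv_half(3)[OF \<tau>'] .
  have a6: "of_real t ^ 6 * a ^ 6 = - 1"
    using t by (simp add: a_def power_divide power_numeral_reduce)
  have "c2pi ^ 5 * (of_real t ^ 6 * ?h + ?h') = c2pi ^ 5 * ?h' - of_real t ^ 6 * (- (c2pi ^ 5) * ?h)"
    by (simp add: algebra_simps)
  also have "\<dots> = c2pi ^ 5 * ?h' * (1 + of_real t ^ 6 * a ^ 6)"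
    unfolding * by (simp add: algebra_simps)
  also have "\<dots> = 0" unfolding a6 by simp
  finally show ?thesis
    unfolding \<tau>_def \<tau>'_def by simp
qed

section \<open>The lattice stable under multiplication by \<i>\<close>

abbreviation tau0 :: complex where "tau0 \<equiv> tau_half 1"
abbreviation q0 :: complex where "q0 \<equiv> nome tau0"

lemma tau0_pos: "Im tau0 > 0"
  by simp

lemma i_eq_tau0: "\<i> = tau0 + tau0 - 1"
  by (simp add: tau_half_def)

lemma i_mult_lattice_tau0_iff: "\<i> * z \<in> lattice tau0 \<longleftrightarrow> z \<in> lattice tau0"
  using lattice_tau_half_iff[of 1 z] by simp

text \<open>The point 1/2 is fixed by \<i> modulo the lattice; evaluating there determines the
  constant left open by \<open>wp_rescale\<close>.\<close>

lemma wp_i_mult: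
  assumes "z \<notin> lattice tau0"
  shows "wp_fn tau0 (\<i> * z) + wp_fn tau0 z = 2 * wp_fn tau0 (1 / 2)"
proof -
  obtain C where C: "\<And>z. z \<notin> lattice tau0 \<Longrightarrow> wp_fn tau0 z = \<i> ^ 2 * wp_fn tau0 (\<i> * z) + C"
    using wp_rescale[OF tau0_pos tau0_pos, of \<i>] i_mult_lattice_tau0_iff by auto
  have "wp_fn tau0 (\<i> * (1 / 2)) = wp_fn tau0 (1 / 2)"
  proof -
    have "\<i> * (1 / 2) = 1 / 2 + (tau0 - 1)"
      by (simp add: tau_half_def field_simps)
    then show ?thesis
      using wp_periodic[OF tau0_pos _ half_notin_lattice[OF tau0_pos], of "tau0 - 1"] by (simp only: lattice_diff tau_in_lattice one_in_lattice)
  qed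
  with C[of "1 / 2"] C[OF assms] half_notin_lattice[OF tau0_pos] show ?thesis
    by simp
qed

text \<open>Legendre's relation for the lattice \<open>lattice tau0\<close>, which is stable under multiplication by \<open>\<i>\<close>.\<close>

lemma wp_half_tau0: "wp_fn tau0 (1 / 2) = - \<i>"
proof -
  let ?S = "- lattice tau0" and ?C = "wp_fn tau0 (1 / 2)"
  \<comment> \<open>The linear term is chosen so that K' = \<i> (wp(\<i>z) + wp(z)) - 2\<i> wp(1/2),
    which is zero by \<open>wp_i_mult\<close>.\<close>
  define K where "K z = zeta_fn tau0 (\<i> * z) + \<i> * zeta_fn tau0 z - 2 * \<i> * ?C * z" for z
  have o: "open ?S" by (rule open_compl_lattice[OF tau0_pos])
  have dz: "(zeta_fn tau0 has_field_derivative wp_fn tau0 z) (at z)" if "z \<in> ?S" for z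
    unfolding wp_fn_def by (rule holomorphic_derivI[OF zeta_holomorphic[OF tau0_pos] o that])
  have dK: "(K has_field_derivative 0) (at z)" if z: "z \<in> ?S" for z
  proof -
    have "(K has_field_derivative (wp_fn tau0 (\<i> * z) * (\<i> * 1) + \<i> * wp_fn tau0 z - 2 * \<i> * ?C * 1)) (at z)"
      unfolding K_def[abs_def]
      using z i_mult_lattice_tau0_iff
      by (intro DERIV_diff DERIV_add DERIV_cmult DERIV_ident DERIV_chain2[where f = "zeta_fn tau0"] dz) auto
    moreover have "wp_fn tau0 (\<i> * z) * (\<i> * 1) + \<i> * wp_fn tau0 z - 2 * \<i> * ?C * 1 = 0"
      using wp_i_mult[of z] z by (simp add: algebra_simps flip: distrib_left)
    ultimately show ?thesis by simp
  qed
  have "continuous_on ?S K"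
    using dK by (intro continuous_at_imp_continuous_on) (auto intro: DERIV_isCont)
  then obtain k where k: "\<And>z. z \<in> ?S \<Longrightarrow> K z = k"
    using DERIV_zero_connected_constant[OF connected_compl_lattice[OF tau0_pos] o, of "{}" K] dK by auto
  have h: "1 / 2 \<notin> lattice tau0" by (rule half_notin_lattice[OF tau0_pos])
  have h': "\<i> * (1 / 2) \<notin> lattice tau0" using h i_mult_lattice_tau0_iff by blast
  \<comment> \<open>A constant that is also odd must be zero.\<close>
  have "K (- (1 / 2)) = - K (1 / 2)"
    using zeta_minus[OF tau0_pos h] zeta_minus[OF tau0_pos h'] by (simp add: K_def)
  moreover have "K (- (1 / 2)) = k" "K (1 / 2) = k" "K (1 / 2 + 1) = k"
    using h by (auto intro!: k simp del: add_divide_eq_iff simp only: Compl_iff lattice_uminus_iff lattice_add_iff one_in_lattice)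
  ultimately have K: "K (1 / 2) = 0" "K (1 / 2 + 1) = 0" by simp_all
  \<comment> \<open>Moving z by 1 moves \<i>z by \<i> = 2 \<open>tau0\<close> - 1, along which the
    quasi-period is 2.\<close>
  have "zeta_fn tau0 (\<i> * (1 / 2) + \<i>) = zeta_fn tau0 (\<i> * (1 / 2) + tau0 + tau0 - 1)"
    using i_eq_tau0 by (metis add.assoc add_diff_eq)
  also have "\<dots> = zeta_fn tau0 (\<i> * (1 / 2) + tau0 + tau0)"
    using zeta_add_1[of tau0 "\<i> * (1 / 2) + tau0 + tau0 - 1"] by simp
  also have "\<dots> = zeta_fn tau0 (\<i> * (1 / 2)) + 1 + 1"
    using h' by (simp only: zeta_add_tau[OF tau0_pos] lattice_add_iff tau_in_lattice not_False_eq_True)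
  finally have "K (1 / 2 + 1) - K (1 / 2) = 2 - 2 * \<i> * ?C"
    unfolding K_def zeta_add_1 by (simp add: algebra_simps)
  with K have "\<i> * ?C = 1" by simp
  then have "\<i> * (\<i> * ?C) = \<i>" by simp
  then show ?thesis by (simp add: minus_equation_iff flip: mult.assoc)
qed

theorem Phi_tilde_0_1_q0: "Phi_tilde 0 1 q0 = of_real (1 / (4 * pi) - 1 / 8)"
proof -
  have "- c2pi * (1 / 4 + 2 * Phi_tilde 0 1 q0) = - \<i>"
    using wp_half_tau0 zeta_deriv_half(1)[OF tau0_pos] by (simp only: wp_fn_def)
  moreover define y where "y = 1 / 4 + 2 * Phi_tilde 0 1 q0"
  ultimately have "2 * of_real pi * y = 1"
    by (simp add: c2pi_def mult.assoc)
  then have "y = of_real (1 / (2 * pi))"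
    by (simp add: field_simps)
  moreover have "Phi_tilde 0 1 q0 = (y - 1 / 4) / 2" by (simp add: y_def)
  ultimately have "Phi_tilde 0 1 q0 = of_real ((1 / (2 * pi) - 1 / 4) / 2)" by simp
  also have "(1 / (2 * pi) - 1 / 4) / 2 = 1 / (4 * pi) - 1 / 8" by (simp add: field_simps)
  finally show ?thesis .
qed

theorem Phi_tilde_0_5_q0: "Phi_tilde 0 5 q0 = of_real (- (1 / 8))"
proof -
  define y where "y = 1 / 4 + 2 * Phi_tilde 0 5 q0"
  have "of_real 1 ^ 6 * y + y = 0"
    using Phi_tilde_0_5_transform[OF zero_less_one] by (simp only: div_by_1 flip: y_def)
  then have "y = 0" by simp
  moreover have "Phi_tilde 0 5 q0 = (y - 1 / 4) / 2" by (simp add: y_def)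
  ultimately show ?thesis by simp
qed

text \<open>With q = -x the Lambert series has nonnegative terms. The sign makes 1 - 16
  \<open>Phi_tilde 0 3 q0\<close> positive, so that it can be divided by and has a real fourth
  root.\<close>

lemma Phi_tilde_0_3_q0: obtains r where "r \<ge> 0" "Phi_tilde 0 3 q0 = - of_real r"
proof -
  define x where "x = exp (- pi)"
  have x: "0 < x" "x < 1" by (simp_all add: x_def)
  have q0: "q0 = - of_real x"
    by (simp add: nome_tau_half x_def exp_of_real flip: of_real_minus)
  have "(\<lambda>k. of_nat k ^ Suc 2 * (- q0) ^ k / (1 - q0 ^ k)) sums (- Phi_tilde 0 (Suc 2) q0)"
    by (rule Phi_tilde_lambert_0) simp
  then have "(\<lambda>k. complex_of_real (real k ^ 3 * x ^ k / (1 - (- x) ^ k))) sums (- Phi_tilde 0 3 q0)"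
    by (simp add: q0 eval_nat_numeral)
  note sums = this
  define r where "r = (\<Sum>k. real k ^ 3 * x ^ k / (1 - (- x) ^ k))"
  have summable: "summable (\<lambda>k. real k ^ 3 * x ^ k / (1 - (- x) ^ k))"
    using sums_summable[OF sums] by (simp only: summable_complex_of_real)
  have "- Phi_tilde 0 3 q0 = of_real r"
    unfolding r_def by (rule sums_unique2[OF sums sums_of_real[OF summable_sums[OF summable]]])
  moreover have "r \<ge> 0"
    unfolding r_def
  proof (rule suminf_nonneg[OF summable])
    fix k
    have "\<bar>(- x) ^ k\<bar> \<le> 1"
      using x by (simp add: power_abs power_le_one)
    then have "(- x) ^ k \<le> 1" by linarith
    then show "0 \<le> real k ^ 3 * x ^ k / (1 - (- x) ^ k)"
      using x by simp
  qed
  ultimately show ?thesis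
    by (intro that[of r]) (simp_all add: minus_equation_iff)
qed

lemma wp_deriv_half_tau0:
  "deriv (wp_fn tau0) (1 / 2) = 0" "(deriv ^^ 3) (wp_fn tau0) (1 / 2) = 0" "(deriv ^^ 4) (wp_fn tau0) (1 / 2) = 0"
  "(deriv ^^ 2) (wp_fn tau0) (1 / 2) = c2pi ^ 3 * (1 / 8 - 2 * Phi_tilde 0 3 q0)"
proof -
  have "deriv (wp_fn tau0) = (deriv ^^ 2) (zeta_fn tau0)"
    by (simp add: wp_fn_def eval_nat_numeral)
  then show "deriv (wp_fn tau0) (1 / 2) = 0"
    using zeta_even_deriv_half[OF tau0_pos, of 2] by simp
  show "(deriv ^^ 3) (wp_fn tau0) (1 / 2) = 0"
    unfolding wp_higher_deriv by (intro zeta_even_deriv_half[OF tau0_pos]) simp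
  have "(deriv ^^ Suc 4) (zeta_fn tau0) (1 / 2) = 0"
    using zeta_deriv_half(3)[OF tau0_pos] Phi_tilde_0_5_q0 by simp
  then show "(deriv ^^ 4) (wp_fn tau0) (1 / 2) = 0"
    unfolding wp_higher_deriv .
  have "(deriv ^^ Suc 2) (zeta_fn tau0) (1 / 2) = c2pi ^ 3 * (1 / 8 - 2 * Phi_tilde 0 3 q0)"
    using zeta_deriv_half(2)[OF tau0_pos] by (simp only: eval_nat_numeral)
  then show "(deriv ^^ 2) (wp_fn tau0) (1 / 2) = c2pi ^ 3 * (1 / 8 - 2 * Phi_tilde 0 3 q0)"
    unfolding wp_higher_deriv .
qed

lemma higher_deriv_wp_rhs:
  assumes h: "z \<notin> lattice tau0" and n: "n > 0"
  shows "(deriv ^^ n) (\<lambda>w. a * (wp_fn tau0 w * wp_fn tau0 w) + (b * wp_fn tau0 w + d)) z =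
    a * (\<Sum>i = 0..n. of_nat (n choose i) * (deriv ^^ i) (wp_fn tau0) z * (deriv ^^ (n - i)) (wp_fn tau0) z) +
    b * (deriv ^^ n) (wp_fn tau0) z"
proof -
  note o = open_compl_lattice[OF tau0_pos] and hol = wp_holomorphic[OF tau0_pos]
  have z: "z \<in> - lattice tau0" using h by simp
  have "(deriv ^^ n) (\<lambda>w. a * (wp_fn tau0 w * wp_fn tau0 w) + (b * wp_fn tau0 w + d)) z =
      (deriv ^^ n) (\<lambda>w. a * (wp_fn tau0 w * wp_fn tau0 w)) z + (deriv ^^ n) (\<lambda>w. b * wp_fn tau0 w + d) z"
    by (rule higher_deriv_add[OF _ _ o z]) (intro holomorphic_intros hol)+
  also have "(deriv ^^ n) (\<lambda>w. b * wp_fn tau0 w + d) z = (deriv ^^ n) (\<lambda>w. b * wp_fn tau0 w) z + (deriv ^^ n) (\<lambda>w. d) z"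
    by (rule higher_deriv_add[OF _ _ o z]) (intro holomorphic_intros hol)+
  also have "(deriv ^^ n) (\<lambda>w. b * wp_fn tau0 w) z = b * (deriv ^^ n) (wp_fn tau0) z"
    by (rule higher_deriv_cmult[OF hol z o])
  also have "(deriv ^^ n) (\<lambda>w. a * (wp_fn tau0 w * wp_fn tau0 w)) z = a * (deriv ^^ n) (\<lambda>w. wp_fn tau0 w * wp_fn tau0 w) z"
    by (rule higher_deriv_cmult[OF _ z o]) (intro holomorphic_intros hol)
  also have "(deriv ^^ n) (\<lambda>w. wp_fn tau0 w * wp_fn tau0 w) z =
      (\<Sum>i = 0..n. of_nat (n choose i) * (deriv ^^ i) (wp_fn tau0) z * (deriv ^^ (n - i)) (wp_fn tau0) z)"
    by (rule higher_deriv_mult[OF hol hol o z])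
  finally show ?thesis using n by simp
qed

lemma binomial_convolution:
  fixes a b :: "nat \<Rightarrow> complex"
  shows "(\<Sum>i = 0..2. of_nat (2 choose i) * a i * b (2 - i)) = a 0 * b 2 + 2 * a 1 * b 1 + a 2 * b 0"
    "(\<Sum>i = 0..4. of_nat (4 choose i) * a i * b (4 - i)) =
      a 0 * b 4 + 4 * a 1 * b 3 + 6 * a 2 * b 2 + 4 * a 3 * b 1 + a 4 * b 0"
    "(\<Sum>i = 0..6. of_nat (6 choose i) * a i * b (6 - i)) =
      a 0 * b 6 + 6 * a 1 * b 5 + 15 * a 2 * b 4 + 20 * a 3 * b 3 + 15 * a 4 * b 2 + 6 * a 5 * b 1 + a 6 * b 0"
  by (simp_all add: sum.atLeast0_atMost_Suc numeral_eq_Suc)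

text \<open>Completing the square about the value -\<i> at 1/2 leaves no linear term, because the
  fourth derivative vanishes there. For the second claim, write v for the second derivative of
  \<open>wp_fn tau0\<close> at 1/2: in the sixth derivative of Ramanujan's identity, the square of
  zeta gives 20 v^2 and the \<wp> term -36 v^2.\<close>

theorem
  shows wp_ode_tau0: "\<And>z. z \<notin> lattice tau0 \<Longrightarrow> (deriv ^^ 2) (wp_fn tau0) z =
      6 * c2pi * (wp_fn tau0 z + \<i>) ^ 2 + c2pi ^ 3 * (1 / 8 - 2 * Phi_tilde 0 3 q0)"
    and Phi_tilde_1_6_q0: "Phi_tilde 1 6 q0 = - ((1 - 16 * Phi_tilde 0 3 q0) ^ 2 / 16)"
proof -
  let ?V = "wp_fn tau0"
  define v where "v = c2pi ^ 3 * (1 / 8 - 2 * Phi_tilde 0 3 q0)"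
  note o = open_compl_lattice[OF tau0_pos] and hol = wp_holomorphic[OF tau0_pos]
  have h: "1 / 2 \<notin> lattice tau0" by (rule half_notin_lattice[OF tau0_pos])
  then have h': "1 / 2 \<in> - lattice tau0" by simp
  have v: "v \<noteq> 0"
  proof -
    obtain r where r: "r \<ge> 0" "Phi_tilde 0 3 q0 = - of_real r"
      using Phi_tilde_0_3_q0 by blast
    have "1 / 8 - 2 * Phi_tilde 0 3 q0 = of_real (1 / 8 + 2 * r)"
      by (simp add: r)
    moreover have "1 / 8 + 2 * r \<noteq> 0" using r by linarith
    ultimately show ?thesis
      unfolding v_def by (simp only: mult_eq_0_iff of_real_eq_0_iff) simp
  qed
  have V0: "?V (1 / 2) = - \<i>" by (rule wp_half_tau0)
  note V = wp_deriv_half_tau0[folded v_def]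
  note conv = binomial_convolution[of "\<lambda>i. (deriv ^^ i) ?V (1 / 2)" "\<lambda>i. (deriv ^^ i) ?V (1 / 2)"]
  obtain A B where AB: "\<And>z. z \<notin> lattice tau0 \<Longrightarrow> (deriv ^^ 2) ?V z = 6 * c2pi * ?V z ^ 2 + A * ?V z + B"
    using wp_ode[OF tau0_pos] by blast
  have ode: "(deriv ^^ (n + 2)) ?V (1 / 2) = (deriv ^^ n) (\<lambda>w. (6 * c2pi) * (?V w * ?V w) + (A * ?V w + B)) (1 / 2)" for n
  proof -
    have "(deriv ^^ n) ((deriv ^^ 2) ?V) (1 / 2) = (deriv ^^ n) (\<lambda>w. (6 * c2pi) * (?V w * ?V w) + (A * ?V w + B)) (1 / 2)"
      by (rule higher_deriv_transform_within_open[OF _ _ o h'])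
        (use AB hol o in \<open>auto intro!: holomorphic_intros simp: power2_eq_square\<close>)
    then show ?thesis by (simp only: funpow_add o_apply)
  qed
  have V2: "v = 6 * c2pi * (- \<i>) ^ 2 + A * (- \<i>) + B"
    using AB[OF h] V V0 by simp
  \<comment> \<open>The second derivative of the equation at 1/2: its left side is the vanishing
    fourth derivative, and v is nonzero, so A can be solved for.\<close>
  have "0 = (6 * c2pi) * (2 * (- \<i> * v)) + A * v"
    using ode[of 2] unfolding higher_deriv_wp_rhs[OF h zero_less_numeral] conv
    by (simp add: V V0)
  then have "(A - 12 * c2pi * \<i>) * v = 0" by (auto simp: algebra_simps)
  then have A: "A = 12 * c2pi * \<i>" using v by simp
  have B: "B = v - 6 * c2pi * (- \<i>) ^ 2 + A * \<i>" using V2 by simp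
  show "(deriv ^^ 2) ?V z = 6 * c2pi * (?V z + \<i>) ^ 2 + c2pi ^ 3 * (1 / 8 - 2 * Phi_tilde 0 3 q0)"
    if "z \<notin> lattice tau0" for z
    unfolding AB[OF that] v_def[symmetric] B A by (simp add: algebra_simps power2_eq_square)
  \<comment> \<open>The first, third and fourth derivatives vanish, so of the Leibniz sum only the
    middle term 6 v^2 survives.\<close>
  have V6: "(deriv ^^ 6) ?V (1 / 2) = 36 * c2pi * v ^ 2"
    using ode[of 4] unfolding higher_deriv_wp_rhs[OF h zero_less_numeral] conv
    by (simp add: V V0 power2_eq_square)
  obtain C where C: "\<And>z. z \<notin> lattice tau0 \<Longrightarrow> zeta_fn tau0 z ^ 2 + 2 * lambert_sq_fn tau0 z - ?V z / c2pi = C"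
    using zeta_square_identity[OF tau0_pos] by blast
  show "Phi_tilde 1 6 q0 = - ((1 - 16 * Phi_tilde 0 3 q0) ^ 2 / 16)"
  proof -
    let ?Z = "zeta_fn tau0" and ?M = "lambert_sq_fn tau0"
    note hols = zeta_holomorphic[OF tau0_pos] lambert_sq_holomorphic[OF tau0_pos] hol
    have "(deriv ^^ 6) (\<lambda>z. ?Z z * ?Z z + (2 * ?M z + (- 1 / c2pi) * ?V z)) (1 / 2) = (deriv ^^ 6) (\<lambda>z. C) (1 / 2)"
      by (rule higher_deriv_transform_within_open[OF _ _ o h'])
        (use C hols in \<open>auto intro!: holomorphic_intros simp: power2_eq_square algebra_simps\<close>)
    also have "\<dots> = 0" by simp
    also have "(deriv ^^ 6) (\<lambda>z. ?Z z * ?Z z + (2 * ?M z + (- 1 / c2pi) * ?V z)) (1 / 2) =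
        (deriv ^^ 6) (\<lambda>z. ?Z z * ?Z z) (1 / 2) + (deriv ^^ 6) (\<lambda>z. 2 * ?M z + (- 1 / c2pi) * ?V z) (1 / 2)"
      by (rule higher_deriv_add[OF _ _ o h']) (intro holomorphic_intros hols)+
    also have "(deriv ^^ 6) (\<lambda>z. 2 * ?M z + (- 1 / c2pi) * ?V z) (1 / 2) =
        (deriv ^^ 6) (\<lambda>z. 2 * ?M z) (1 / 2) + (deriv ^^ 6) (\<lambda>z. (- 1 / c2pi) * ?V z) (1 / 2)"
      by (rule higher_deriv_add[OF _ _ o h']) (intro holomorphic_intros hols)+
    also have "(deriv ^^ 6) (\<lambda>z. 2 * ?M z) (1 / 2) = 2 * (deriv ^^ 6) ?M (1 / 2)"
      by (rule higher_deriv_cmult[OF hols(2) h' o])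
    also have "(deriv ^^ 6) (\<lambda>z. (- 1 / c2pi) * ?V z) (1 / 2) = (- 1 / c2pi) * (deriv ^^ 6) ?V (1 / 2)"
      by (rule higher_deriv_cmult[OF hols(3) h' o])
    also have "(deriv ^^ 6) (\<lambda>z. ?Z z * ?Z z) (1 / 2) =
        (\<Sum>i = 0..6. of_nat (6 choose i) * (deriv ^^ i) ?Z (1 / 2) * (deriv ^^ (6 - i)) ?Z (1 / 2))"
      by (rule higher_deriv_mult[OF hols(1) hols(1) o h'])
    \<comment> \<open>Even derivatives of zeta at 1/2 vanish and so does the fifth, which leaves the
      middle binomial term.\<close>
    also have "\<dots> = 20 * v ^ 2"
    proof -
      have "(deriv ^^ Suc n) ?Z (1 / 2) = (deriv ^^ n) ?V (1 / 2)" for n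
        by (simp only: wp_higher_deriv)
      from this[of 2] this[of 4] have "(deriv ^^ 3) ?Z (1 / 2) = v" "(deriv ^^ 5) ?Z (1 / 2) = 0"
        unfolding V by (simp_all only: eval_nat_numeral)
      then show ?thesis
        unfolding binomial_convolution[of "\<lambda>i. (deriv ^^ i) ?Z (1 / 2)" "\<lambda>i. (deriv ^^ i) ?Z (1 / 2)"] using zeta_even_deriv_half[OF tau0_pos] by (simp add: power2_eq_square)
    qed
    finally have "2 * (deriv ^^ 6) ?M (1 / 2) = 16 * v ^ 2"
      unfolding V6 by (simp add: algebra_simps)
    moreover define F where "F = 1 - 16 * Phi_tilde 0 3 q0"
    then have "v = c2pi ^ 3 * (F / 8)" by (simp add: v_def diff_divide_distrib)
    ultimately have "4 * (c2pi ^ 6 * (F ^ 2 / 16)) = - (4 * (c2pi ^ 6 * Phi_tilde 1 6 q0))"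
      unfolding lambert_sq_deriv6_half[OF tau0_pos] by (simp add: power_mult_distrib power_divide)
    then have "4 * (c2pi ^ 6 * (Phi_tilde 1 6 q0 + F ^ 2 / 16)) = 0"
      by (simp only: distrib_left add.right_inverse)
    then have "Phi_tilde 1 6 q0 + F ^ 2 / 16 = 0" by simp
    then show ?thesis
      unfolding F_def by (simp only: eq_neg_iff_add_eq_0)
  qed
qed

section \<open>The lemniscatic period\<close>

text \<open>
  The first integral is \<open>y'\<^sup>2 = 4 y (y\<^sup>2 + k)\<close>, and \<open>y\<^sup>2 / (y\<^sup>2 + k)\<close> substitutes into
  the Beta integral.
\<close>

theorem lemniscate_period:
  fixes y y' :: "real \<Rightarrow> real"
  assumes k: "k > 0" and h: "h > 0"
    and y: "\<And>s. - h < s \<Longrightarrow> s < h \<Longrightarrow> (y has_real_derivative y' s) (at s)"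
    and y': "\<And>s. - h < s \<Longrightarrow> s < h \<Longrightarrow> (y' has_real_derivative 6 * y s ^ 2 + 2 * k) (at s)"
    and init: "y 0 = 0" "y' 0 = 0"
    and blowup: "((\<lambda>s. (h - s) ^ 2 * y s) \<longlongrightarrow> 1) (at_left h)"
  shows "Beta (1 / 4) (1 / 4) = 4 * k powr (1 / 4) * h"
proof -
  have y'_pos: "y' s > 0" if "0 < s" "s < h" for s
  proof -
    have "y' 0 < y' s"
    proof (rule DERIV_pos_imp_increasing[OF that(1)])
      fix x assume "0 \<le> x" "x \<le> s"
      then show "\<exists>d. (y' has_real_derivative d) (at x) \<and> d > 0"
        using y'[of x] that h k by (intro exI[of _ "6 * y x ^ 2 + 2 * k"]) (auto intro: add_nonneg_pos)
    qed
    with init show ?thesis by simp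
  qed
  have y_pos: "y s > 0" if "0 < s" "s < h" for s
  proof -
    have "y 0 < y s"
    proof (rule DERIV_pos_imp_increasing_open[OF that(1)])
      fix x assume "0 < x" "x < s"
      then show "\<exists>d. (y has_real_derivative d) (at x) \<and> d > 0"
        using y[of x] y'_pos[of x] that h by auto
    next
      show "continuous_on {0..s} y"
        using DERIV_isCont[OF y] that h by (intro continuous_at_imp_continuous_on) auto
    qed
    with init show ?thesis by simp
  qed
  have "\<exists>c. \<forall>s\<in>{- h<..<h}. y' s ^ 2 - 4 * y s ^ 3 - 4 * k * y s = c"
  proof (rule has_field_derivative_zero_constant)
    fix s assume "s \<in> {- h<..<h}"
    then have s: "- h < s" "s < h" by auto
    have "((\<lambda>s. y' s ^ 2 - 4 * y s ^ 3 - 4 * k * y s) has_real_derivative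
        of_nat 2 * y' s ^ 1 * (6 * y s ^ 2 + 2 * k) - 4 * (of_nat 3 * y s ^ 2 * y' s) - 4 * k * y' s) (at s)"
      by (rule derivative_eq_intros y[OF s] y'[OF s] refl | simp add: algebra_simps power2_eq_square)+
    also have "of_nat 2 * y' s ^ 1 * (6 * y s ^ 2 + 2 * k) - 4 * (of_nat 3 * y s ^ 2 * y' s) - 4 * k * y' s = 0"
      by (simp add: algebra_simps)
    finally show "((\<lambda>s. y' s ^ 2 - 4 * y s ^ 3 - 4 * k * y s) has_real_derivative 0) (at s within {- h<..<h})"
      by (rule has_field_derivative_at_within)
  qed auto
  then obtain c where c: "\<And>s. s \<in> {- h<..<h} \<Longrightarrow> y' s ^ 2 - 4 * y s ^ 3 - 4 * k * y s = c"
    by blast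
  from c[of 0] h init have "c = 0" by simp
  have y'_eq: "y' s = 2 * (sqrt (y s) * sqrt (y s ^ 2 + k))" if "0 < s" "s < h" for s
  proof -
    have "(2 * (sqrt (y s) * sqrt (y s ^ 2 + k))) ^ 2 = 4 * (y s * (y s ^ 2 + k))"
      using y_pos[OF that] k by (simp add: power_mult_distrib)
    then have "y' s ^ 2 = (2 * (sqrt (y s) * sqrt (y s ^ 2 + k))) ^ 2"
      using c[of s] \<open>c = 0\<close> that h by (simp add: algebra_simps power2_eq_square power3_eq_cube)
    then show ?thesis
      using y'_pos[OF that] y_pos[OF that] k by (subst (asm) power2_eq_iff_nonneg) (auto intro: add_nonneg_nonneg)
  qed
  define g where "g s = y s ^ 2 / (y s ^ 2 + k)" for s
  define f where "f t = t powr (- 3 / 4) * (1 - t) powr (- 3 / 4)" for t :: real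
  \<comment> \<open>This is the derivative of \<open>g\<close> written through \<open>g\<close>
    alone; as a result the Beta integrand pulls back to a constant, and the integral is proportional
    to \<open>h\<close>.\<close>
  define g' where "g' s = 4 * k powr (1 / 4) * ((g s) powr (3 / 4) * (1 - g s) powr (3 / 4))" for s
  have w: "y s ^ 2 + k > 0" for s using k by (intro add_nonneg_pos) auto
  have g: "0 < g s" "g s < 1" "1 - g s = k / (y s ^ 2 + k)" if "0 < s" "s < h" for s
    using y_pos[OF that] k w[of s] by (auto simp: g_def field_simps)
  have dg: "(g has_real_derivative g' s) (at s)" if s: "0 < s" "s < h" for s
  proof -
    define Y where "Y = y s"
    define W where "W = Y ^ 2 + k"
    have Y: "Y > 0" and W: "W > 0" using y_pos[OF s] w[of s] by (auto simp: Y_def W_def)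
    have "(g has_real_derivative ((2 * y s * y' s) * (y s ^ 2 + k) - y s ^ 2 * (2 * y s * y' s)) / (y s ^ 2 + k) ^ 2) (at s)"
      unfolding g_def[abs_def] using y[of s] s h w[of s]
      by (auto intro!: derivative_eq_intros simp: power2_eq_square)
    also have "((2 * y s * y' s) * (y s ^ 2 + k) - y s ^ 2 * (2 * y s * y' s)) / (y s ^ 2 + k) ^ 2
        = 4 * k * Y * (sqrt Y * sqrt W) / (W * (sqrt W * sqrt W))"
      using W unfolding y'_eq[OF s] by (simp add: Y_def W_def algebra_simps power2_eq_square)
    also have "\<dots> = (4 * k * (Y * sqrt Y)) * sqrt W / ((W * sqrt W) * sqrt W)"
      by (simp only: mult_ac)
    also have "\<dots> = (4 * k * (Y * sqrt Y)) / (W * sqrt W)"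
      using W by (intro nonzero_mult_divide_mult_cancel_right) simp
    also have "\<dots> = 4 * k * ((Y * sqrt Y) / (W * sqrt W))"
      by simp
    also have "\<dots> = g' s"
    proof -
      have "Y * sqrt Y = Y powr 1 * Y powr (1 / 2)" "W * sqrt W = W powr 1 * W powr (1 / 2)"
        using Y W by (simp_all add: powr_half_sqrt)
      then have 1: "Y * sqrt Y = Y powr (3 / 2)" "W * sqrt W = W powr (3 / 4) * W powr (3 / 4)"
        unfolding powr_add[symmetric] by simp_all
      have 2: "k powr (1 / 4) * k powr (3 / 4) = k"
        unfolding powr_add[symmetric] using k by simp
      have 3: "(Y ^ 2) powr (3 / 4) = Y powr (3 / 2)"
        using powr_powr[of Y 2 "3 / 4"] Y by simp
      have "g' s = 4 * k powr (1 / 4) * ((Y ^ 2 / W) powr (3 / 4) * (k / W) powr (3 / 4))"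
        unfolding g'_def g(3)[OF s] by (simp add: g_def Y_def W_def)
      also have "\<dots> = 4 * (k powr (1 / 4) * k powr (3 / 4)) * (Y powr (3 / 2) / (W powr (3 / 4) * W powr (3 / 4)))"
        using Y W k by (simp add: powr_divide 3)
      finally show ?thesis unfolding 1 2 by simp
    qed
    finally show ?thesis .
  qed
  have fg: "f (g s) * g' s = 4 * k powr (1 / 4)" if "0 < s" "s < h" for s
  proof -
    have "f (g s) * g' s = 4 * k powr (1 / 4) * ((g s powr (- 3 / 4) * g s powr (3 / 4)) *
        ((1 - g s) powr (- 3 / 4) * (1 - g s) powr (3 / 4)))"
      by (simp add: f_def g'_def mult_ac)
    then show ?thesis
      unfolding powr_add[symmetric] using g(1,2)[OF that] by simp
  qed
  have y0: "isCont y 0" "isCont g 0"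
    using DERIV_isCont[OF y[of 0]] h w[of 0] by (auto simp: g_def[abs_def] intro!: continuous_intros)
  have lim0: "(g \<longlongrightarrow> 0) (at_right 0)"
    using isContD[OF y0(2)] init by (simp add: g_def filterlim_at_split)
  have lim1: "(g \<longlongrightarrow> 1) (at_left h)"
  proof (rule Lim_transform_eventually)
    \<comment> \<open>Multiplying numerator and denominator of \<open>g\<close> by (h - s)^4
      replaces the double pole of \<open>y\<close> by the finite limit 1.\<close>
    let ?u = "\<lambda>s. (h - s) ^ 2 * y s"
    have "((\<lambda>s. ?u s ^ 2 / (?u s ^ 2 + k * (h - s) ^ 4)) \<longlongrightarrow> 1 ^ 2 / (1 ^ 2 + k * (h - h) ^ 4)) (at_left h)"
      by (intro tendsto_intros blowup) auto
    then show "((\<lambda>s. ?u s ^ 2 / (?u s ^ 2 + k * (h - s) ^ 4)) \<longlongrightarrow> 1) (at_left h)"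
      by simp
    have "\<forall>\<^sub>F s in at_left h. s \<noteq> h" by (simp add: eventually_at_filter)
    then show "\<forall>\<^sub>F s in at_left h. ?u s ^ 2 / (?u s ^ 2 + k * (h - s) ^ 4) = g s"
    proof eventually_elim
      case (elim s)
      have "?u s ^ 2 / (?u s ^ 2 + k * (h - s) ^ 4) = ((h - s) ^ 4 * y s ^ 2) / ((h - s) ^ 4 * (y s ^ 2 + k))"
        by (simp add: power_mult_distrib algebra_simps flip: power_mult)
      also have "\<dots> = g s" using elim unfolding g_def by (subst mult_divide_mult_cancel_left) auto
      finally show ?case .
    qed
  qed
  have real_lim: "((ereal \<circ> g \<circ> real_of_ereal) \<longlongrightarrow> ereal l) (at_right (ereal a))" if "(g \<longlongrightarrow> l) (at_right a)" for l a
    using that by (simp only: ereal_tendsto_simps)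
  have subst: "set_integrable lborel (einterval (ereal 0) (ereal 1)) f"
    "(LBINT t=ereal 0..ereal 1. f t) = (LBINT s=ereal 0..ereal h. f (g s) * g' s)"
  proof -
    have "set_integrable lborel (einterval (ereal 0) (ereal h)) (\<lambda>s. f (g s) * g' s)"
    proof -
      have "set_integrable lborel {0<..<h} (\<lambda>s. 4 * k powr (1 / 4))"
        using interval_integral_const(1)[of 0 h "4 * k powr (1 / 4)"] h
        unfolding interval_lebesgue_integrable_def einterval_eq by simp
      also have "?this \<longleftrightarrow> set_integrable lborel {0<..<h} (\<lambda>s. f (g s) * g' s)"
        by (intro set_integrable_cong) (use fg in auto)
      finally show ?thesis by (simp add: einterval_eq)
    qed
    note * = interval_integral_substitution_nonneg[of "ereal 0" "ereal h" g g' f "ereal 0" "ereal 1", OF _ _ _ _ _ _ _ _ this]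
    have cont_f: "isCont f (g s)" if "0 < s" "s < h" for s
      unfolding f_def[abs_def] using g[OF that] by (auto intro!: continuous_intros)
    have cont_g': "isCont g' s" if "0 < s" "s < h" for s
      unfolding g'_def[abs_def] using g[OF that] DERIV_isCont[OF dg[OF that]] by (auto intro!: continuous_intros)
    have "((ereal \<circ> g \<circ> real_of_ereal) \<longlongrightarrow> ereal 1) (at_left (ereal h))"
      using lim1 by (simp only: ereal_tendsto_simps)
    then show "set_integrable lborel (einterval (ereal 0) (ereal 1)) f"
      "(LBINT t=ereal 0..ereal 1. f t) = (LBINT s=ereal 0..ereal h. f (g s) * g' s)"
      using h dg cont_f cont_g' real_lim[OF lim0] k
      by (intro *; simp add: f_def g'_def)+
  qed
  have "(LBINT s=ereal 0..ereal h. f (g s) * g' s) = (LBINT s=ereal 0..ereal h. 4 * k powr (1 / 4))"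
    using h by (intro interval_integral_cong) (auto simp: fg einterval_eq)
  also have "\<dots> = 4 * k powr (1 / 4) * h"
    by simp
  finally have "(LBINT t=ereal 0..ereal 1. f t) = 4 * k powr (1 / 4) * h"
    using subst by simp
  moreover have "(LBINT t=ereal 0..ereal 1. f t) = integral {0<..<1} f"
    using subst(1) set_borel_integral_eq_integral(2)[of "{0<..<1}" f]
    by (simp add: interval_lebesgue_integral_def einterval_eq)
  moreover have "(f has_integral Beta (1 / 4) (1 / 4)) {0<..<1}"
    using has_integral_Beta_real[of "1 / 4" "1 / 4"] by (simp add: f_def[abs_def] has_integral_Icc_iff_Ioo)
  ultimately show ?thesis
    by (simp add: integral_unique)
qed

section \<open>Reality on the real axis and the period\<close>

lemma real_notin_Ints: "0 < x \<Longrightarrow> x < 1 \<Longrightarrow> (x :: real) \<notin> \<int>"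
  by (auto elim!: Ints_cases)

lemma of_real_in_lattice:
  assumes "Im \<tau> > 0" "of_real x \<in> lattice \<tau>"
  shows "x \<in> \<int>"
proof -
  obtain m n where x: "of_real x = of_int m + of_int n * \<tau>"
    using assms(2) unfolding lattice_def by blast
  have "Im (complex_of_real x) = of_int n * Im \<tau>" unfolding x by simp
  with assms(1) have "n = 0" by simp
  with x have "x = of_int m" by (metis add.right_neutral mult_zero_left of_int_0 of_real_eq_iff of_real_of_int_eq)
  then show ?thesis by simp
qed

lemma nome_minus_cnj: "nome (- cnj z) = cnj (nome z)"
proof -
  have "c2pi * - cnj z = cnj (c2pi * z)" by (simp add: c2pi_def)
  then show ?thesis unfolding nome_def by (simp only: exp_cnj)
qed

text \<open>Reflection in the imaginary axis conjugates the nome and sends \<open>tau0\<close> to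
  \<open>tau0\<close> - 1; period 1 absorbs the resulting integer shifts.\<close>

lemma dsum_tau0_minus_cnj:
  assumes f: "nome_series a f" and 1: "\<And>z. f (z + 1) = f z" and cnj: "\<And>z. f (- cnj z) = cnj (f z)"
  shows "dsum tau0 f (- cnj z) = cnj (dsum tau0 f z)"
proof -
  have f_add_nat: "f (z + of_nat n) = f z" for z n
  proof (induction n)
    case (Suc n)
    then show ?case using 1[of "z + of_nat n"] by (simp add: add_ac)
  qed simp
  have "f (- cnj z + of_nat n * tau0) = cnj (f (z + of_nat n * tau0))" for n
  proof -
    have "- cnj z + of_nat n * tau0 = - cnj (z + of_nat n * tau0) + of_nat n"
      by (simp add: tau_half_def complex_eq_iff)
    then show ?thesis by (simp only: f_add_nat cnj)
  qed
  then show ?thesis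
    unfolding dsum_def using bounded_linear.suminf[OF bounded_linear_cnj dsum_summable[OF f tau0_pos]]
    by simp
qed

text \<open>On the real axis the reflection is z to -z, so oddness makes \<open>zeta_fn tau0\<close>
  equal to minus its own conjugate.\<close>

lemma Re_zeta_tau0_real:
  assumes "x \<notin> \<int>"
  shows "Re (zeta_fn tau0 (of_real x)) = 0"
proof -
  have x: "complex_of_real x \<notin> lattice tau0"
    using of_real_in_lattice[OF tau0_pos] assms by blast
  have lambert_fn: "lambert_fn tau0 (- cnj z) = cnj (lambert_fn tau0 z)" for z
    unfolding lambert_fn_def by (rule dsum_tau0_minus_cnj[OF geo_nome_series geo_add_1]) (simp add: geo_def nome_minus_cnj)
  have "zeta_fn tau0 (- of_real x) = cnj (zeta_fn tau0 (of_real x))"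
  proof -
    have "tau0 - (- of_real x) = - cnj (tau0 - of_real x) + 1"
      by (simp add: tau_half_def complex_eq_iff)
    then have "lambert_fn tau0 (tau0 - (- of_real x)) = cnj (lambert_fn tau0 (tau0 - of_real x))"
      by (simp only: lambert_fn_add_1 lambert_fn)
    moreover have "lambert_fn tau0 (- of_real x) = cnj (lambert_fn tau0 (of_real x))"
      using lambert_fn[of "of_real x"] by simp
    ultimately show ?thesis
      unfolding zeta_fn_def by (simp del: diff_minus_eq_add)
  qed
  with zeta_minus[OF tau0_pos x] show ?thesis
    by (simp add: complex_eq_iff)
qed

lemma
  assumes "(f has_field_derivative D) (at (complex_of_real x))"
  shows has_real_derivative_Re: "((\<lambda>x. Re (f (of_real x))) has_real_derivative Re D) (at x)"
    and has_real_derivative_Im: "((\<lambda>x. Im (f (of_real x))) has_real_derivative Im D) (at x)"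
  using has_vector_derivative_real_field[OF assms, of UNIV]
    bounded_linear.has_vector_derivative[OF bounded_linear_Re]
    bounded_linear.has_vector_derivative[OF bounded_linear_Im]
  unfolding has_real_derivative_iff_has_vector_derivative by blast+

lemma Re_wp_tau0_real:
  assumes "0 < x" "x < 1"
  shows "Re (wp_fn tau0 (of_real x)) = 0"
proof -
  have *: "u \<notin> \<int>" if "u \<in> {0<..<1}" for u :: real
    using that real_notin_Ints by auto
  have "of_real x \<in> - lattice tau0"
    using of_real_in_lattice[OF tau0_pos] * assms by auto
  then have "(zeta_fn tau0 has_field_derivative wp_fn tau0 (of_real x)) (at (of_real x))"
    unfolding wp_fn_def by (rule holomorphic_derivI[OF zeta_holomorphic[OF tau0_pos] open_compl_lattice[OF tau0_pos]])
  from has_real_derivative_Re[OF this]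
  have "((\<lambda>x. Re (zeta_fn tau0 (of_real x))) has_real_derivative Re (wp_fn tau0 (of_real x))) (at x)" .
  moreover have "\<forall>\<^sub>F u in nhds x. u \<in> {0<..<1}"
    using assms by (intro eventually_nhds_in_open) auto
  then have "\<forall>\<^sub>F u in nhds x. Re (zeta_fn tau0 (of_real u)) = 0"
    by eventually_elim (use * Re_zeta_tau0_real in blast)
  ultimately have "((\<lambda>x. 0) has_real_derivative Re (wp_fn tau0 (of_real x))) (at x)"
    by (subst (asm) DERIV_cong_ev[where y = x and g = "\<lambda>_. 0"]) auto
  then show ?thesis
    using DERIV_unique DERIV_const by blast
qed

lemma Beta_tau0:
  assumes r: "r \<ge> 0" "Phi_tilde 0 3 q0 = - of_real r"
  shows "Beta (1 / 4) (1 / 4) = 2 * (pi ^ 4 * (1 + 16 * r)) powr (1 / 4)"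
proof -
  let ?V = "wp_fn tau0"
  \<comment> \<open>Multiplying \<open>wp_ode_tau0\<close> by \<open>c2pi\<close> shows 2k = c2pi^4
    (1/8 - 2 \<open>Phi_tilde 0 3 q0\<close>).\<close>
  define k where "k = pi ^ 4 * (1 + 16 * r)"
  \<comment> \<open>On the real axis this is c2pi (wp + \<i>), which is real because wp is purely
    imaginary there. Measuring s from the half period places the pole at s = 1/2.\<close>
  define y where "y s = - 2 * pi * (Im (?V (of_real (1 / 2 + s))) + 1)" for s
  define y' where "y' s = - 2 * pi * Im (deriv ?V (of_real (1 / 2 + s)))" for s
  have notin: "complex_of_real (1 / 2 + s) \<in> - lattice tau0" if "- (1 / 2) < s" "s < 1 / 2" for s
    using of_real_in_lattice[OF tau0_pos, of "1 / 2 + s"] real_notin_Ints[of "1 / 2 + s"] that by auto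
  note hol = wp_holomorphic[OF tau0_pos] and o = open_compl_lattice[OF tau0_pos]
  have hol': "deriv ?V holomorphic_on - lattice tau0"
    by (intro holomorphic_deriv hol o)
  have "Beta (1 / 4) (1 / 4) = 4 * k powr (1 / 4) * (1 / 2)"
  proof (rule lemniscate_period)
    show "k > 0" using r by (simp add: k_def add_pos_nonneg)
    show "y 0 = 0" "y' 0 = 0"
      by (simp_all add: y_def y'_def wp_half_tau0 wp_deriv_half_tau0)
    fix s :: real assume s: "- (1 / 2) < s" "s < 1 / 2"
    note dV = has_real_derivative_Im[OF holomorphic_derivI[OF hol o notin[OF s]]]
    note dV' = has_real_derivative_Im[OF holomorphic_derivI[OF hol' o notin[OF s]]]
    have shift: "((\<lambda>s. 1 / 2 + s) has_real_derivative 1) (at s)"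
      by (auto intro!: derivative_eq_intros)
    from DERIV_cmult[OF DERIV_add[OF DERIV_chain2[OF dV shift] DERIV_const[of 1]], of "- 2 * pi"]
    show "(y has_real_derivative y' s) (at s)"
      unfolding y_def[abs_def] y'_def by simp
    from DERIV_cmult[OF DERIV_chain2[OF dV' shift], of "- 2 * pi"]
    have "(y' has_real_derivative - 2 * pi * Im (deriv (deriv ?V) (of_real (1 / 2 + s)))) (at s)"
      unfolding y'_def[abs_def] by simp
    moreover have "- 2 * pi * Im (deriv (deriv ?V) (of_real (1 / 2 + s))) = 6 * y s ^ 2 + 2 * k"
    proof -
      define w where "w = Im (?V (of_real (1 / 2 + s)))"
      have V: "?V (of_real (1 / 2 + s)) = \<i> * of_real w"
        using Re_wp_tau0_real[of "1 / 2 + s"] s by (simp add: complex_eq_iff w_def)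
      have "deriv (deriv ?V) (of_real (1 / 2 + s)) =
          6 * c2pi * (\<i> * of_real w + \<i>) ^ 2 + c2pi ^ 3 * (1 / 8 - 2 * Phi_tilde 0 3 q0)"
        using wp_ode_tau0[of "of_real (1 / 2 + s)"] notin[OF s] unfolding V by (simp add: numeral_2_eq_2)
      also have "\<dots> = \<i> * of_real (- 12 * pi * (w + 1) ^ 2 - pi ^ 3 * (1 + 16 * r))"
        by (simp add: c2pi_def r algebra_simps power2_eq_square power3_eq_cube)
      finally have "Im (deriv (deriv ?V) (of_real (1 / 2 + s))) = - 12 * pi * (w + 1) ^ 2 - pi ^ 3 * (1 + 16 * r)"
        by simp
      then show ?thesis
        by (simp only: y_def k_def flip: w_def) (simp add: algebra_simps power_numeral_reduce)
    qed
    ultimately show "(y' has_real_derivative 6 * y s ^ 2 + 2 * k) (at s)" by simp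
  next
    \<comment> \<open>The period 1 moves the pole at 1 to the one at 0, where the asymptotics are
      known.\<close>
    have "filterlim (\<lambda>s. complex_of_real (s - 1 / 2)) (at 0) (at_left (1 / 2))"
    proof (rule filterlim_atI)
      have "((\<lambda>s. complex_of_real (s - 1 / 2)) \<longlongrightarrow> of_real (1 / 2 - 1 / 2)) (at_left (1 / 2))"
        by (intro tendsto_intros)
      then show "((\<lambda>s. complex_of_real (s - 1 / 2)) \<longlongrightarrow> 0) (at_left (1 / 2))"
        by simp
      show "\<forall>\<^sub>F s in at_left (1 / 2). complex_of_real (s - 1 / 2) \<noteq> 0"
        unfolding of_real_eq_0_iff by (simp add: eventually_at_filter)
    qed
    from filterlim_compose[OF wp_tendsto_0[OF tau0_pos] this]
    have lim: "((\<lambda>s. Im (of_real (s - 1 / 2) ^ 2 * ?V (of_real (s - 1 / 2)))) \<longlongrightarrow> Im (1 / c2pi)) (at_left (1 / 2))"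
      by (rule tendsto_Im)
    have "((\<lambda>s. - 2 * pi * (Im (of_real (s - 1 / 2) ^ 2 * ?V (of_real (s - 1 / 2))) + (s - 1 / 2) ^ 2)) \<longlongrightarrow>
        - 2 * pi * (Im (1 / c2pi) + (1 / 2 - 1 / 2) ^ 2)) (at_left (1 / 2))"
      by (rule tendsto_mult[OF tendsto_const tendsto_add[OF lim]]) (intro tendsto_intros)
    moreover have "- 2 * pi * (Im (1 / c2pi) + (1 / 2 - 1 / 2) ^ 2) = 1"
      by (simp add: c2pi_def Im_divide power2_eq_square)
    ultimately have "((\<lambda>s. - 2 * pi * (Im (of_real (s - 1 / 2) ^ 2 * ?V (of_real (s - 1 / 2))) + (s - 1 / 2) ^ 2)) \<longlongrightarrow> 1)
        (at_left (1 / 2))"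
      by (simp only:)
    then show "((\<lambda>s. (1 / 2 - s) ^ 2 * y s) \<longlongrightarrow> 1) (at_left (1 / 2))"
    proof (rule Lim_transform_eventually)
      have "\<forall>\<^sub>F s in at_left (1 / 2). s \<in> {0<..<1 / 2::real}"
        by (rule eventually_at_leftI[of 0]) auto
      then show "\<forall>\<^sub>F s in at_left (1 / 2). - 2 * pi * (Im (of_real (s - 1 / 2) ^ 2 * ?V (of_real (s - 1 / 2))) + (s - 1 / 2) ^ 2) =
          (1 / 2 - s) ^ 2 * y s"
      proof eventually_elim
        case (elim s)
        then have "of_real (s - 1 / 2) \<notin> lattice tau0"
          using notin[of s] lattice_add_iff[OF one_in_lattice, of "of_real (s - 1 / 2)" tau0] by simp
        from wp_add_1[OF tau0_pos this]
        have "?V (of_real (1 / 2 + s)) = ?V (of_real (s - 1 / 2))"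
          by (simp add: algebra_simps)
        moreover have "Im (of_real (s - 1 / 2) ^ 2 * z) = (s - 1 / 2) ^ 2 * Im z" for z
          by (simp flip: of_real_power)
        ultimately show ?case
          unfolding y_def by (simp add: algebra_simps power2_eq_square)
      qed
    qed
  qed simp
  then show ?thesis by (simp add: k_def)
qed

section \<open>From the Beta integral to \<Gamma>(3/4)\<close>

lemma Gamma_quarter: "Gamma (1 / 4 :: real) * Gamma (3 / 4) = pi * sqrt 2"
proof -
  have "Gamma (complex_of_real (1 / 4)) * Gamma (1 - complex_of_real (1 / 4)) = of_real pi / sin (of_real pi * of_real (1 / 4))"
    by (rule Gamma_reflection_complex)
  also have "1 - complex_of_real (1 / 4) = of_real (3 / 4)" by simp
  also have "of_real pi * complex_of_real (1 / 4) = of_real (pi / 4)" by simp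
  finally have "complex_of_real (Gamma (1 / 4) * Gamma (3 / 4)) = of_real (pi / sin (pi / 4))"
    by (simp only: Gamma_complex_of_real sin_of_real flip: of_real_mult of_real_divide)
  then have "Gamma (1 / 4) * Gamma (3 / 4) = pi / sin (pi / 4)"
    by (simp only: of_real_eq_iff)
  also have "\<dots> = pi * (2 / sqrt 2)" by (simp add: sin_45)
  also have "2 / sqrt 2 = sqrt 2" by (rule real_div_sqrt) simp
  finally show ?thesis .
qed

text \<open>The fourth power of the period relation gives \<Gamma>(1/4)^8 = 16 \<pi>^6 F, and the
  reflection formula trades this for F \<Gamma>(3/4)^8 = \<pi>^2.\<close>

theorem Phi_tilde_1_6_q0_Gamma: "Phi_tilde 1 6 q0 = of_real (- (pi ^ 4 / (16 * Gamma (3 / 4) ^ 16)))"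
proof -
  obtain r where r: "r \<ge> 0" "Phi_tilde 0 3 q0 = - of_real r"
    using Phi_tilde_0_3_q0 by blast
  define F where "F = 1 + 16 * r"
  define G where "G = Gamma (3 / 4 :: real)"
  have F: "F > 0" using r by (simp add: F_def add_pos_nonneg)
  have G: "G > 0" by (simp add: G_def Gamma_real_pos)
  have "Gamma (1 / 4) * Gamma (1 / 4) / sqrt pi = 2 * (pi ^ 4 * F) powr (1 / 4)"
    using Beta_tau0[OF r] by (simp add: Beta_def Gamma_one_half_real F_def)
  then have "(Gamma (1 / 4) * Gamma (1 / 4) / sqrt pi) ^ 4 = 16 * ((pi ^ 4 * F) powr (1 / 4)) ^ 4"
    by (simp add: power_mult_distrib)
  also have "((pi ^ 4 * F) powr (1 / 4)) ^ 4 = pi ^ 4 * F"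
    using F powr_realpow[of "(pi ^ 4 * F) powr (1 / 4)" 4] by (simp add: powr_powr)
  finally have "Gamma (1 / 4) ^ 8 / pi ^ 2 = 16 * (pi ^ 4 * F)"
    by (simp add: power_divide power_mult_distrib power_numeral_reduce mult_ac)
  then have "Gamma (1 / 4) ^ 8 = 16 * pi ^ 6 * F"
    by (simp add: field_simps power_numeral_reduce)
  moreover have "Gamma (1 / 4) ^ 8 * G ^ 8 = pi ^ 8 * 16"
    unfolding power_mult_distrib[symmetric] G_def Gamma_quarter
    by (simp add: power_mult_distrib power_numeral_reduce)
  ultimately have "F * G ^ 8 = pi ^ 2"
    by (simp add: power_numeral_reduce field_simps)
  then have "F = pi ^ 2 / G ^ 8" using G by (simp add: field_simps)
  then have "F ^ 2 / 16 = pi ^ 4 / (16 * G ^ 16)"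
    by (simp add: power_divide flip: power_mult)
  moreover have "Phi_tilde 1 6 q0 = - of_real (F ^ 2 / 16)"
    unfolding Phi_tilde_1_6_q0 r F_def by simp
  ultimately show ?thesis by (simp add: G_def)
qed

section \<open>Differentiation in the parameter t\<close>

lemma Phi_tilde_has_field_derivative:
  assumes q: "norm q < 1"
  shows "(Phi_tilde r s has_field_derivative deriv (Phi_tilde r s) q) (at q)"
proof -
  define c where "c n = (of_nat n ^ r * of_int (sigma_tilde (s - r) n) :: complex)" for n
  have sums: "(\<lambda>n. c n * z ^ n) sums Phi_tilde r s z" if "norm z < 1" for z
  proof -
    have "c 0 = 0" by (simp add: c_def sigma_tilde_def)
    then show ?thesis
      using Phi_tilde_sums[OF that, of r s] unfolding c_def[symmetric]
      by (subst (asm) sums_Suc_iff) simp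
  qed
  have "((\<lambda>z. \<Sum>n. c n * z ^ n) has_field_derivative (\<Sum>n. diffs c n * q ^ n)) (at q)"
    by (rule termdiffs_strong'[OF _ q]) (use sums sums_summable in blast)
  then have "(Phi_tilde r s has_field_derivative (\<Sum>n. diffs c n * q ^ n)) (at q)"
    by (rule has_field_derivative_cong_open[of "ball 0 1", rotated 3])
      (use q sums in \<open>auto simp: sums_iff\<close>)
  then show ?thesis by (metis DERIV_imp_deriv)
qed

text \<open>Along this path d/dt is -\<pi> times q d/dq, and q d/dq raises both indices since s - r
  is unchanged.\<close>

lemma Phi_tilde_tau_half_vector_derivative:
  assumes t: "t > 0"
  shows "((\<lambda>t. Phi_tilde r s (nome (tau_half t))) has_vector_derivative
    - of_real pi * Phi_tilde (Suc r) (Suc s) (nome (tau_half t))) (at t)"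
proof -
  have "((\<lambda>z. - exp (- (of_real pi * z))) has_field_derivative of_real pi * exp (- (of_real pi * of_real t))) (at (complex_of_real t))"
    by (auto intro!: derivative_eq_intros)
  from has_vector_derivative_real_field[OF this]
  have n: "((\<lambda>t. nome (tau_half t)) has_vector_derivative - of_real pi * nome (tau_half t)) (at t)"
    by (simp add: nome_tau_half)
  have "norm (nome (tau_half t)) < 1" using t by simp
  from field_vector_diff_chain_at[OF n Phi_tilde_has_field_derivative[OF this, of r s]]
  show ?thesis
    by (simp add: o_def Phi_tilde_def q_deriv_def mult.assoc)
qed

text \<open>The first derivative of the transformation law at t = 1 gives nothing new, since the two
  contributions of \<open>Phi_tilde 1 6\<close> cancel there; the second one relates it to
  \<open>Phi_tilde 2 7\<close>.\<close>

theorem Phi_tilde_2_7_q0: "Phi_tilde 2 7 q0 = 7 / of_real pi * Phi_tilde 1 6 q0"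
proof -
  define P where "P r s t = Phi_tilde r s (nome (tau_half t))" for r s t
  have P: "(P r s has_vector_derivative - of_real pi * P (Suc r) (Suc s) t) (at t)" if "t > 0" for r s t
    unfolding P_def by (rule Phi_tilde_tau_half_vector_derivative[OF that])
  have P_inv: "((\<lambda>t. P r s (1 / t)) has_vector_derivative (1 / of_real t ^ 2) * (of_real pi * P (Suc r) (Suc s) (1 / t))) (at t)"
    if t: "t > 0" for r s t
  proof -
    have "((\<lambda>t. 1 / t) has_real_derivative - 1 / t ^ 2) (at t)"
      using t by (auto intro!: derivative_eq_intros simp: power2_eq_square)
    then have "((\<lambda>t. 1 / t) has_vector_derivative - 1 / t ^ 2) (at t)"
      by (simp only: has_real_derivative_iff_has_vector_derivative)
    from vector_diff_chain_at[OF this P[of "1 / t" r s]] t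
    show ?thesis
      by (simp add: o_def scaleR_conv_of_real)
  qed
  have pow: "((\<lambda>t. complex_of_real t ^ n) has_vector_derivative of_nat n * of_real t ^ (n - 1)) (at t)" for n t
  proof -
    have "((\<lambda>z. z ^ n) has_field_derivative of_nat n * of_real t ^ (n - 1)) (at (complex_of_real t))"
      by (rule derivative_eq_intros refl | simp)+
    from has_vector_derivative_real_field[OF this] show ?thesis .
  qed
  have zero: "D = 0" if "(F has_vector_derivative D) (at t)" "t > 0" "\<And>t. t > 0 \<Longrightarrow> F t = 0"
    for F :: "real \<Rightarrow> complex" and D t
  proof -
    have "\<forall>\<^sub>F u in nhds t. u \<in> {0<..}"
      using that(2) by (intro eventually_nhds_in_open) auto
    then have "\<forall>\<^sub>F u in nhds t. F u = 0" by eventually_elim (use that(3) in auto)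
    then have "((\<lambda>_. 0) has_vector_derivative D) (at t)"
      using that by (subst (asm) has_vector_derivative_cong_ev) auto
    then show ?thesis
      using vector_derivative_unique_at has_vector_derivative_const by blast
  qed
  have E0: "of_real t ^ 6 * (1 / 4 + 2 * P 0 5 t) + (1 / 4 + 2 * P 0 5 (1 / t)) = 0" if "t > 0" for t
    using Phi_tilde_0_5_transform[OF that] by (simp add: P_def)
  \<comment> \<open>This is the derivative of \<open>E0\<close> multiplied by t^2 / 2, which clears
    the factor t^(-2) from differentiating 1/t.\<close>
  have E1: "of_real t ^ 8 * (- of_real pi * P 1 6 t) + 3 * (of_real t ^ 7 * (1 / 4 + 2 * P 0 5 t)) + of_real pi * P 1 6 (1 / t) = 0"
    if t: "t > 0" for t
  proof -
    let ?D = "of_real t ^ 6 * (0 + 2 * (- of_real pi * P (Suc 0) (Suc 5) t)) + of_nat 6 * of_real t ^ (6 - 1) * (1 / 4 + 2 * P 0 5 t) +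
      (0 + 2 * ((1 / of_real t ^ 2) * (of_real pi * P (Suc 0) (Suc 5) (1 / t))))"
    have "((\<lambda>t. of_real t ^ 6 * (1 / 4 + 2 * P 0 5 t) + (1 / 4 + 2 * P 0 5 (1 / t))) has_vector_derivative ?D) (at t)"
      by (intro has_vector_derivative_add has_vector_derivative_mult has_vector_derivative_mult_right
          has_vector_derivative_const pow P P_inv t)
    from zero[OF this t E0] have "of_real t ^ 2 / 2 * ?D = 0" by (simp only: mult_zero_right)
    then show ?thesis
      using t by (simp add: algebra_simps power_numeral_reduce)
  qed
  let ?D = "of_real 1 ^ 8 * (- of_real pi * (- of_real pi * P (Suc 1) (Suc 6) 1)) + of_nat 8 * of_real 1 ^ (8 - 1) * (- of_real pi * P 1 6 1) +
    3 * (of_real 1 ^ 7 * (0 + 2 * (- of_real pi * P (Suc 0) (Suc 5) 1)) + of_nat 7 * of_real 1 ^ (7 - 1) * (1 / 4 + 2 * P 0 5 1)) +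
    of_real pi * ((1 / of_real 1 ^ 2) * (of_real pi * P (Suc 1) (Suc 6) (1 / 1)))"
  have "((\<lambda>t. of_real t ^ 8 * (- of_real pi * P 1 6 t) + 3 * (of_real t ^ 7 * (1 / 4 + 2 * P 0 5 t)) + of_real pi * P 1 6 (1 / t))
      has_vector_derivative ?D) (at 1)"
    by (intro has_vector_derivative_add has_vector_derivative_mult has_vector_derivative_mult_right
        has_vector_derivative_const pow P P_inv zero_less_one)
  from zero[OF this zero_less_one E1] have "?D = 0" .
  moreover have "1 / 4 + 2 * P 0 5 1 = 0"
    using Phi_tilde_0_5_q0 by (simp add: P_def)
  \<comment> \<open>The coefficient 14\<pi> of \<open>P 1 6 1\<close> is 8\<pi> from differentiating
    t^8 plus 6\<pi> from differentiating \<open>P 0 5\<close>; the term with 21 carries the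
    vanishing value at t = 1.\<close>
  moreover have "2 * of_real pi * (of_real pi * P 2 7 1 - 7 * P 1 6 1) = ?D - 21 * (1 / 4 + 2 * P 0 5 1)"
  proof -
    have "Suc 0 = 1" "Suc 1 = 2" "Suc 5 = 6" "Suc 6 = 7" by simp_all
    then show ?thesis by (simp only:) (simp add: algebra_simps)
  qed
  ultimately have "2 * of_real pi * (of_real pi * P 2 7 1 - 7 * P 1 6 1) = 0"
    by (simp only: mult_zero_right diff_0_right)
  then show ?thesis
    by (simp add: P_def field_simps)
qed

theorem corollary2p18:
  shows "Phi_tilde 0 1 (- exp (- of_real pi)) = of_real (1 / (4 * pi) - 1 / 8) \<and>
    Phi_tilde 0 5 (- exp (- of_real pi)) = of_real (- (1 / 8)) \<and>
    Phi_tilde 1 6 (- exp (- of_real pi)) = of_real (- (pi ^ 4 / (16 * Gamma (3 / 4) ^ 16))) \<and>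
    Phi_tilde 2 7 (- exp (- of_real pi)) = of_real (- (7 * pi ^ 3 / (16 * Gamma (3 / 4) ^ 16)))"
proof -
  have q0: "- exp (- of_real pi) = q0"
    by (simp add: nome_tau_half)
  have "Phi_tilde 2 7 q0 = of_real (7 / pi * - (pi ^ 4 / (16 * Gamma (3 / 4) ^ 16)))"
    unfolding Phi_tilde_2_7_q0 Phi_tilde_1_6_q0_Gamma by simp
  also have "7 / pi * - (pi ^ 4 / (16 * Gamma (3 / 4) ^ 16)) = - (7 * pi ^ 3 / (16 * Gamma (3 / 4) ^ 16))"
    by (simp add: power_numeral_reduce)
  finally show ?thesis
    unfolding q0 using Phi_tilde_0_1_q0 Phi_tilde_0_5_q0 Phi_tilde_1_6_q0_Gamma by blast
qed

end
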